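(* Let $\sigma\ge0$. Let $f_{\theta_1}\in L^{\infty}_{\mathrm{loc}}(\mathbb{R})$ be measurable, periodic with period $1$, with $f_{\theta_1}(t)-\sigma>\varsigma$ a.e. for some $\varsigma>0$, and suppose that the firing map $\Phi_{\theta_1}$ of $\dot{x}=-\sigma x+f_{\theta_1}(t)$ has irrational rotation number. Then for every $\varepsilon>0$ there exists a neighbourhood $\mathcal{U}$ of $f_{\theta_1}$ in the $L^{\infty}_{\mathrm{loc}}(\mathbb{R})$-topology such that for every $f_{\theta_2}\in\mathcal{U}$ that is measurable, periodic with period $1$ and satisfies $f_{\theta_2}(t)-\sigma>0$ a.e., and for every initial condition $(t,0)$, $t\in\mathbb{R}$, $$d_F\Big(\lim_{n\to\infty}\omega^{(\theta_2)}_{n,t},\ \mu^{(\theta_1)}_{\mathrm{ISI}}\Big)<\varepsilon,$$ where $\omega^{(\theta_2)}_{n,t}$ is the empirical interspike-interval distribution of the run of $\dot{x}=-\sigma x+f_{\theta_2}(t)$ starting from $(t,0)$ (the limit being the weak limit of measures) and $\mu^{(\theta_1)}_{\mathrm{ISI}}$ is the interspike-interval distribution for $\dot{x}=-\sigma x+f_{\theta_1}(t)$ with respect to its invariant measure.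
   Context: Periodic with period $1$ means $f(t+1)=f(t)$ for a.e. $t$. The firing map of $\dot{x}=-\sigma x+f(t)$ is $\Phi(t):=\inf\{t_*>t:\ e^{\sigma t}\le\int_t^{t_*}[f(u)-\sigma]e^{\sigma u}\,du\}$; under the assumptions it is a lift of an orientation preserving circle homeomorphism $\varphi$, with rotation number $\lim_n\Phi^n(t)/n$. If the rotation number is irrational, $\mu$ is the unique invariant Borel probability measure of $\varphi$, regarded on $[0,1]$ (endpoints identified), and $\mu_{\mathrm{ISI}}(A):=\mu(\{t\in[0,1]:\Phi(t)-t\in A\})$ for Borel $A\subset\mathbb{R}$. The empirical interspike-interval distribution for the run of length $n$ starting at $(t,0)$ is $\omega_{n,t}=\frac1n\sum_{i=0}^{n-1}\delta_{\Phi^{i+1}(t)-\Phi^i(t)}$. The Fortet–Mourier distance of Borel probability measures $\mu,\nu$ on a compact metric space $X$ (here a compact interval of $\mathbb{R}$ containing the supports) is $d_F(\mu,\nu)=\sup\{|\int_X h\,d\mu-\int_X h\,d\nu|: h \text{ is } 1\text{-Lipschitz}\}$. The topology of $L^\infty_{\mathrm{loc}}(\mathbb{R})$ is given by the seminorms $\operatorname{ess\,sup}_{[-k,k]}|f|$, $k\in\mathbb{N}$. *)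

theory Defs
  imports "HOL-Probability.Probability"
begin

section \<open>Periodically driven integrate-and-fire models\<close>

definition periodic1 :: "(real \<Rightarrow> real) \<Rightarrow> bool" where
  "periodic1 f \<longleftrightarrow> (AE t in lebesgue. f (t + 1) = f t)"

definition firing_map :: "real \<Rightarrow> (real \<Rightarrow> real) \<Rightarrow> real \<Rightarrow> real" where
  "firing_map \<sigma> f t =
     Inf {s. s > t \<and> exp (\<sigma> * t) \<le> (LINT u:{t..s}|lebesgue. (f u - \<sigma>) * exp (\<sigma> * u))}"

definition has_rotation_number :: "(real \<Rightarrow> real) \<Rightarrow> real \<Rightarrow> bool" where
  "has_rotation_number \<Phi> \<rho> \<longleftrightarrow> (\<forall>t. (\<lambda>n. (\<Phi> ^^ n) t / real n) \<longlonglongrightarrow> \<rho>)"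

section \<open>Interspike-interval distributions\<close>

text \<open>The circle is represented by the fundamental domain \<open>{0..<1}\<close>, on which the circle map with
  lift \<open>\<Phi>\<close> is \<open>t \<mapsto> frac (\<Phi> t)\<close>. Identifying \<open>0\<close> with \<open>1\<close> does not change the Borel sets:
  \<open>{0..<1}\<close> and the circle are isomorphic as Borel spaces.\<close>

definition circle_invariant_measure :: "(real \<Rightarrow> real) \<Rightarrow> real measure \<Rightarrow> bool" where
  "circle_invariant_measure \<Phi> \<mu> \<longleftrightarrow>
     prob_space \<mu> \<and> sets \<mu> = sets (restrict_space borel {0..<1}) \<and>
     (\<lambda>t. frac (\<Phi> t)) \<in> measurable \<mu> \<mu> \<and> distr \<mu> \<mu> (\<lambda>t. frac (\<Phi> t)) = \<mu>"

text \<open>Only meaningful when the circle map is uniquely ergodic, for instance when it is a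
  homeomorphism with irrational rotation number.\<close>

definition the_invariant_measure :: "(real \<Rightarrow> real) \<Rightarrow> real measure" where
  "the_invariant_measure \<Phi> = (THE \<mu>. circle_invariant_measure \<Phi> \<mu>)"

definition isi_distribution :: "(real \<Rightarrow> real) \<Rightarrow> real measure" where
  "isi_distribution \<Phi> = distr (the_invariant_measure \<Phi>) borel (\<lambda>t. \<Phi> t - t)"

text \<open>The image of the uniform distribution on \<open>{..<n}\<close> under \<open>i \<mapsto> \<Phi>\<^sup>i\<^sup>+\<^sup>1 t - \<Phi>\<^sup>i t\<close> is the average of
  the corresponding point masses.\<close>

definition empirical_isi :: "(real \<Rightarrow> real) \<Rightarrow> real \<Rightarrow> nat \<Rightarrow> real measure" where
  "empirical_isi \<Phi> t n =
     distr (uniform_count_measure {..<n}) borel (\<lambda>i. (\<Phi> ^^ Suc i) t - (\<Phi> ^^ i) t)"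

section \<open>The Fortet--Mourier distance on a compact set\<close>

text \<open>Measures on \<open>X\<close> are represented by Borel measures on the real line concentrated on \<open>X\<close>. The
  supremum is taken in the extended reals, so it cannot be an unspecified value.\<close>

definition fortet_mourier :: "real set \<Rightarrow> real measure \<Rightarrow> real measure \<Rightarrow> ereal" where
  "fortet_mourier X \<mu> \<nu> =
     (SUP h \<in> {h :: real \<Rightarrow> real. 1-lipschitz_on X h}.
        ereal \<bar>(LINT x:X|\<mu>. h x) - (LINT x:X|\<nu>. h x)\<bar>)"

section \<open>The topology of locally essentially bounded functions\<close>

definition Linf_seminorm :: "nat \<Rightarrow> (real \<Rightarrow> real) \<Rightarrow> ennreal" where
  "Linf_seminorm k f = esssup (lebesgue_on {- real k..real k}) (\<lambda>x. ennreal \<bar>f x\<bar>)"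

definition Linf_loc :: "(real \<Rightarrow> real) set" where
  "Linf_loc = {f. f \<in> borel_measurable lebesgue \<and> (\<forall>k. Linf_seminorm k f < \<infinity>)}"

text \<open>A topology on functions rather than on classes modulo equality almost everywhere. Functions
  that agree almost everywhere lie in the same open sets, so the open sets correspond to those of
  the quotient.\<close>

definition Linf_loc_topology :: "(real \<Rightarrow> real) topology" where
  "Linf_loc_topology = topology_generated_by
     {{g \<in> Linf_loc. Linf_seminorm k (\<lambda>x. g x - f x) < ennreal r} | f k r. f \<in> Linf_loc \<and> 0 < r}"

end

theory Submission
  imports Defs
begin

text \<open>For a circle homeomorphism with lift \<open>\<Phi>\<close> and irrational rotation number \<open>\<rho>\<close>, the Birkhoff sums
  of a function of bounded variation have oscillation \<open>o(N)\<close>, with a rate that depends only on \<open>\<Phi>\<close>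
  and the variation. For a 1-Lipschitz function \<open>h\<close> the observable \<open>t \<mapsto> h (\<Phi> t - t)\<close> has variation
  at most 2, so one length \<open>N\<close> serves all \<open>h\<close> and all starting points, and the means of length \<open>N\<close>
  are close to the mean with respect to the invariant measure. For that fixed \<open>N\<close>, a perturbation
  of the input that is small in the essential supremum norm moves the first \<open>N\<close> iterates of the
  firing map little, uniformly in the starting point. Hence all block means of length \<open>N\<close> of the
  perturbed map are close to the unperturbed mean, and so is their limit. The limit exists also when
  the perturbed rotation number \<open>p/q\<close> is rational: \<open>\<Phi>\<^sup>q - p\<close> is monotone and its orbits are bounded,
  so every orbit converges to a periodic one.\<close>

section \<open>Lifts of circle homeomorphisms\<close>

text \<open>A perturbed map may have rational rotation number and then several invariant measures,
  and its limit may depend on the run. Continuity of the invariant measure in the map would not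
  cover all these runs, so the comparison is made over a finite time, where the ergodic theory of
  the perturbed map plays no part. The order of choices matters: \<open>N\<close> depends on the
  unperturbed map and the accuracy, then the closeness of the iterates up to \<open>N\<close> is
  fixed, then the seminorm and the radius of the neighbourhood. The oscillation estimate is in the
  spirit of Denjoy and Koksma. It sees an observable only through its variation, which replaces a
  compactness argument over all 1-Lipschitz functions. A firing time is the moment when a primitive
  of the input reaches a threshold. An error in the primitive becomes an error in time after
  division by a slope, which the gap \<zeta> of the unperturbed input bounds from below.\<close>

lemma quasi_periodic_int:
  fixes g :: "real \<Rightarrow> real"
  assumes "\<And>x. g (x + 1) = g x + c"
  shows "g (x + of_int m) = g x + of_int m * c"
proof (induction m arbitrary: x rule: int_induct[where k = 0])
  case (step1 i)
  have "g (x + of_int (i + 1)) = g ((x + of_int i) + 1)" by (simp add: add.assoc)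
  also have "\<dots> = g x + of_int (i + 1) * c" by (subst assms) (simp add: step1 algebra_simps)
  finally show ?case .
next
  case (step2 i)
  have "g (x + of_int i) = g ((x + of_int (i - 1)) + 1)" by (simp add: algebra_simps)
  then show ?case using step2(2)[of x] by (subst (asm) assms) (simp add: algebra_simps)
qed simp

text \<open>Between consecutive integer translates of \<open>a\<close> the function is squeezed by
  monotonicity, and at the translates its values are exact. With \<open>V = 1\<close> this controls
  the iterates of a lift, with general \<open>V\<close> the dominating functions of the oscillation
  bound.\<close>

lemma mono_quasi_periodic_deviation:
  fixes W :: "real \<Rightarrow> real"
  assumes "mono W" "\<And>x. W (x + 1) = W x + V"
  shows "\<bar>W b - W a - V * (b - a)\<bar> \<le> V"
proof -
  define m where "m = \<lfloor>b - a\<rfloor>"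
  have m: "of_int m \<le> b - a" "b - a \<le> of_int m + 1" unfolding m_def by linarith+
  have "V \<ge> 0" using monoD[OF assms(1), of 0 1] assms(2)[of 0] by simp
  then have "V * of_int m \<le> V * (b - a)" "V * (b - a) \<le> V * (of_int m + 1)"
    using m mult_left_mono by blast+
  moreover have "W (a + of_int m) \<le> W b" "W b \<le> W (a + of_int (m + 1))"
    using m by (auto intro!: monoD[OF assms(1)])
  ultimately show ?thesis
    using quasi_periodic_int[of W V a m, OF assms(2)] quasi_periodic_int[of W V a "m + 1", OF assms(2)]
    by (simp add: algebra_simps)
qed

lemma frac_quasi_periodic:
  fixes g :: "real \<Rightarrow> real"
  assumes "\<And>x. g (x + 1) = g x"
  shows "g (frac x) = g x"
  using quasi_periodic_int[of g 0 x "- \<lfloor>x\<rfloor>"] assms by (simp add: frac_def)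

text \<open>The overlap of the shifted windows cancels. A difference of two sums of length
  \<open>N\<close> is thereby traded for one of length \<open>q\<close>.\<close>

lemma sum_lessThan_shift_diff:
  fixes w :: "nat \<Rightarrow> real"
  shows "(\<Sum>i<N. w (i + q)) - (\<Sum>i<N. w i) = (\<Sum>i<q. w (N + i)) - (\<Sum>i<q. w i)"
proof (induction N)
  case (Suc N)
  have "(\<Sum>i<q. w (Suc N + i)) - (\<Sum>i<q. w (N + i)) = w (N + q) - w N"
    using sum_lessThan_telescope[of "\<lambda>i. w (N + i)" q] by (simp add: sum_subtractf)
  with Suc show ?case by simp
qed simp

lemma eventually_divide_of_nat_less:
  fixes c :: real
  assumes "c > 0" "e > 0"
  shows "\<forall>\<^sub>F n in sequentially. c / real n < e"
  using assms by real_asymp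

section \<open>Rotation numbers and bounded deviation\<close>

locale circle_lift =
  fixes \<Phi> :: "real \<Rightarrow> real"
  assumes cont: "continuous_on UNIV \<Phi>" and smono: "strict_mono \<Phi>"
    and shift: "\<Phi> (x + 1) = \<Phi> x + 1"
begin

lemma iterate: "circle_lift (\<Phi> ^^ n)"
proof (induction n)
  case 0 show ?case by unfold_locales (auto simp: strict_mono_def)
next
  case (Suc n)
  interpret it: circle_lift "\<Phi> ^^ n" by fact
  show ?case
    by unfold_locales
      (auto simp: it.shift shift o_def strict_mono_def
        intro!: continuous_on_compose2[OF cont it.cont] strict_monoD[OF smono] strict_monoD[OF it.smono])
qed

lemma iterate_shift: "(\<Phi> ^^ n) (x + 1) = (\<Phi> ^^ n) x + 1"
  using circle_lift.shift[OF iterate] .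

lemma iterate_shift_int: "(\<Phi> ^^ n) (x + of_int m) = (\<Phi> ^^ n) x + of_int m"
  using quasi_periodic_int[of "\<Phi> ^^ n" 1 x m] by (simp add: iterate_shift)

lemma iterate_strict_mono: "strict_mono (\<Phi> ^^ n)"
  using circle_lift.smono[OF iterate] .

lemma iterate_less: "x < y \<Longrightarrow> (\<Phi> ^^ n) x < (\<Phi> ^^ n) y"
  using strict_monoD[OF iterate_strict_mono] .

lemma iterate_le: "x \<le> y \<Longrightarrow> (\<Phi> ^^ n) x \<le> (\<Phi> ^^ n) y"
  using iterate_less[of x y n] by (cases "x = y") auto

lemma iterate_cont: "continuous_on UNIV (\<Phi> ^^ n)"
  using circle_lift.cont[OF iterate] .

lemma iterate_deviation: "\<bar>(\<Phi> ^^ n) b - (\<Phi> ^^ n) a - (b - a)\<bar> \<le> 1"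
  using mono_quasi_periodic_deviation[of "\<Phi> ^^ n" 1 b a] iterate_strict_mono iterate_shift
  by (simp add: strict_mono_mono)

text \<open>Each block of \<open>m\<close> iterates displaces its starting point as it displaces
  \<open>y\<close>, up to an error 1, and the \<open>n\<close> errors add up.\<close>

lemma iterate_mult_deviation: "\<bar>(\<Phi> ^^ (m * n)) x - x - real n * ((\<Phi> ^^ m) y - y)\<bar> \<le> real n"
proof (induction n)
  case (Suc n)
  have "(\<Phi> ^^ (m * Suc n)) x = (\<Phi> ^^ m) ((\<Phi> ^^ (m * n)) x)" by (simp add: funpow_add)
  moreover have "\<bar>(\<Phi> ^^ m) ((\<Phi> ^^ (m * n)) x) - (\<Phi> ^^ m) y - ((\<Phi> ^^ (m * n)) x - y)\<bar> \<le> 1"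
    by (rule iterate_deviation)
  ultimately show ?case using Suc by (simp add: algebra_simps)
qed simp

text \<open>Dividing the previous bound by \<open>n\<close> and letting \<open>n\<close> tend to
  infinity replaces the displacement per block by \<open>real m * \<rho>\<close>. The bound 1 holds
  for every \<open>m\<close>, far better than the o(m) in the definition of the rotation
  number.\<close>

lemma rotation_number_deviation:
  assumes "has_rotation_number \<Phi> \<rho>"
  shows "\<bar>(\<Phi> ^^ m) x - x - real m * \<rho>\<bar> \<le> 1"
proof (cases "m = 0")
  case False
  let ?d = "(\<Phi> ^^ m) x - x"
  have "(\<lambda>n. (\<Phi> ^^ n) x / real n) \<longlonglongrightarrow> \<rho>" using assms by (simp add: has_rotation_number_def)
  then have "(\<lambda>n. (\<Phi> ^^ (m * n)) x / real (m * n)) \<longlonglongrightarrow> \<rho>"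
    by (rule filterlim_compose) (use False in \<open>auto intro: filterlim_subseq simp: strict_mono_def\<close>)
  then have "(\<lambda>n. real m * ((\<Phi> ^^ (m * n)) x / real (m * n)) - x / real n) \<longlonglongrightarrow> real m * \<rho> - 0"
    by (intro tendsto_diff tendsto_mult tendsto_const)
      (auto intro!: real_tendsto_divide_at_top filterlim_real_sequentially)
  then have "(\<lambda>n. \<bar>real m * ((\<Phi> ^^ (m * n)) x / real (m * n)) - x / real n - ?d\<bar>) \<longlonglongrightarrow> \<bar>real m * \<rho> - 0 - ?d\<bar>"
    by (intro tendsto_rabs tendsto_diff[OF _ tendsto_const])
  moreover have "\<forall>\<^sub>F n in sequentially. \<bar>real m * ((\<Phi> ^^ (m * n)) x / real (m * n)) - x / real n - ?d\<bar> \<le> 1"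
    using eventually_gt_at_top[of 0]
  proof eventually_elim
    case (elim n)
    have "real m * ((\<Phi> ^^ (m * n)) x / real (m * n)) - x / real n - ?d
       = ((\<Phi> ^^ (m * n)) x - x - real n * ?d) / real n"
      using elim False by (simp add: field_simps)
    then show ?case using iterate_mult_deviation[of m n x x] elim by (simp add: abs_divide)
  qed
  ultimately have "\<bar>real m * \<rho> - 0 - ?d\<bar> \<le> 1"
    by (rule tendsto_upperbound) simp
  then show ?thesis by (simp add: abs_minus_commute)
qed simp

lemma ex_rotation_number: "\<exists>\<rho>. has_rotation_number \<Phi> \<rho>"
proof -
  define a where "a n = (\<Phi> ^^ n) 0" for n
  have *: "\<bar>a n / n - a m / m\<bar> \<le> 1 / n + 1 / m" if "n > 0" "m > 0" for m n
  proof -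
    \<comment> \<open>The iterate of order \<open>m * n\<close> is read once as \<open>n\<close>
      blocks of length \<open>m\<close> and once as \<open>m\<close> blocks of length
      \<open>n\<close>.\<close>
    have "\<bar>a (m * n) - real n * a m\<bar> \<le> n" "\<bar>a (n * m) - real m * a n\<bar> \<le> m"
      using iterate_mult_deviation[of m n 0 0] iterate_mult_deviation[of n m 0 0] by (auto simp: a_def)
    then have "\<bar>real m * a n - real n * a m\<bar> \<le> real m + real n" by (simp add: mult.commute)
    then have "\<bar>real m * a n - real n * a m\<bar> / (m * n) \<le> (real m + real n) / (m * n)"
      by (rule divide_right_mono) simp
    moreover have "a n / n - a m / m = (real m * a n - real n * a m) / (m * n)"
      "1 / n + 1 / m = (real m + real n) / (m * n)"
      using that by (auto simp: field_simps)
    ultimately show ?thesis using that by (simp add: abs_divide)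
  qed
  have "Cauchy (\<lambda>n. a n / n)"
  proof (rule metric_CauchyI)
    fix e :: real assume "e > 0"
    then have "\<forall>\<^sub>F n in sequentially. 1 / real n < e / 2"
      by (intro eventually_divide_of_nat_less) auto
    then obtain M where M: "\<And>n. n \<ge> M \<Longrightarrow> 1 / real n < e / 2"
      by (auto simp: eventually_at_top_linorder)
    have "dist (a m / m) (a n / n) < e" if "m \<ge> max 1 M" "n \<ge> max 1 M" for m n
      using *[of m n] M[of m] M[of n] that by (simp add: dist_real_def)
    then show "\<exists>M. \<forall>m\<ge>M. \<forall>n\<ge>M. dist (a m / m) (a n / n) < e" by blast
  qed
  then obtain \<rho> where \<rho>: "(\<lambda>n. a n / n) \<longlonglongrightarrow> \<rho>"
    using Cauchy_convergent convergentD by blast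
  have "(\<lambda>n. (\<Phi> ^^ n) t / real n) \<longlonglongrightarrow> \<rho>" for t
  proof -
    have "(\<lambda>n. (\<Phi> ^^ n) t / real n - a n / n) \<longlonglongrightarrow> 0"
    proof (rule tendsto_rabs_zero_cancel, rule tendsto_sandwich[where f = "\<lambda>_. 0"])
      show "\<forall>\<^sub>F n in sequentially. \<bar>(\<Phi> ^^ n) t / real n - a n / n\<bar> \<le> (\<bar>t\<bar> + 1) / real n"
      proof (intro always_eventually allI)
        fix n
        have "\<bar>(\<Phi> ^^ n) t - a n\<bar> \<le> \<bar>t\<bar> + 1" using iterate_deviation[of n t 0] by (simp add: a_def)
        then show "\<bar>(\<Phi> ^^ n) t / real n - a n / n\<bar> \<le> (\<bar>t\<bar> + 1) / real n"
          by (simp add: abs_divide divide_right_mono flip: diff_divide_distrib)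
      qed
      show "(\<lambda>n. (\<bar>t\<bar> + 1) / real n) \<longlonglongrightarrow> 0" by real_asymp
    qed auto
    from tendsto_add[OF this \<rho>] show ?thesis by simp
  qed
  then show ?thesis unfolding has_rotation_number_def by blast
qed

end

text \<open>\<open>W\<close> plays the role of the cumulative variation of \<open>g\<close>, and
  \<open>V\<close> that of the variation over one period. A dominating function is carried along
  instead of a supremum over partitions because the telescoping in the oscillation bound acts on
  \<open>W\<close> itself.\<close>

definition dominated_variation :: "(real \<Rightarrow> real) \<Rightarrow> (real \<Rightarrow> real) \<Rightarrow> real \<Rightarrow> bool" where
  "dominated_variation g W V \<longleftrightarrow> (\<forall>x. g (x + 1) = g x) \<and> (\<forall>x. W (x + 1) = W x + V) \<and>
     (\<forall>x y. x \<le> y \<longrightarrow> \<bar>g y - g x\<bar> \<le> W y - W x)"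

lemma dominated_variationD:
  assumes "dominated_variation g W V"
  shows "g (x + 1) = g x" "W (x + 1) = W x + V" "x \<le> y \<Longrightarrow> \<bar>g y - g x\<bar> \<le> W y - W x"
    and "mono W" "V \<ge> 0" "\<bar>g x - g y\<bar> \<le> V" "g (x + of_int m) = g x"
proof -
  show 1: "\<And>x. g (x + 1) = g x" and 2: "\<And>x. W (x + 1) = W x + V"
    and 3: "\<And>x y. x \<le> y \<Longrightarrow> \<bar>g y - g x\<bar> \<le> W y - W x"
    using assms by (auto simp: dominated_variation_def)
  show "mono W"
  proof
    fix x y :: real assume "x \<le> y"
    then show "W x \<le> W y" using 3[of x y] by linarith
  qed
  show "V \<ge> 0" using 3[of 0 1] 2[of 0] by simp
  show 4: "g (x + of_int m) = g x" for x m using quasi_periodic_int[of g 0 x m] 1 by simp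
  define m where "m = \<lfloor>y - x\<rfloor>"
  have m: "x + of_int m \<le> y" "y \<le> x + of_int m + 1" unfolding m_def by linarith+
  have "\<bar>g y - g (x + of_int m)\<bar> \<le> W y - W (x + of_int m)" using 3 m by blast
  also have "\<dots> \<le> V" using monoD[OF \<open>mono W\<close> m(2)] 2 by simp
  finally show "\<bar>g x - g y\<bar> \<le> V" using 4 by (simp add: abs_minus_commute)
qed

text \<open>Put \<open>D = \<Phi>\<^sup>q - p\<close>, of rotation number \<open>\<delta>\<close>. Up to an integer, \<open>y\<close> lies between \<open>D\<^sup>j x\<close> and
  \<open>D\<^sup>j\<^sup>+\<^sup>1 x\<close> with \<open>j < J\<close>. Replacing \<open>x\<close> by \<open>D\<^sup>j x\<close> shifts the sum by \<open>q j\<close> terms. The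
  difference of the sums at \<open>y\<close> and \<open>D\<^sup>j x\<close> is at most that of the sums of \<open>W\<close> at \<open>D\<^sup>j\<^sup>+\<^sup>1 x\<close> and
  \<open>D\<^sup>j x\<close>, which telescopes.\<close>

lemma (in circle_lift) birkhoff_oscillation_bound:
  assumes rot: "has_rotation_number \<Phi> \<rho>"
    and dom: "dominated_variation g W V"
    and \<delta>: "\<delta> = real q * \<rho> - of_int p" "real J * \<delta> \<ge> 2"
  shows "\<bar>(\<Sum>i<N. g ((\<Phi> ^^ i) y)) - (\<Sum>i<N. g ((\<Phi> ^^ i) x))\<bar>
      \<le> V * (real N * \<delta> + 2 * real q + real q * real J)"
proof -
  note D = dominated_variationD[OF dom]
  define S where "S z = (\<Sum>i<N. g ((\<Phi> ^^ i) z))" for z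
  have S_shift: "S (z + of_int m) = S z" for z m
    by (simp add: S_def iterate_shift_int D)
  define R where "R j = (\<Phi> ^^ (q * j)) x - of_int p * real j" for j
  have R_Suc: "(\<Phi> ^^ q) (R j) = R (Suc j) + of_int p" for j
    using iterate_shift_int[of q "(\<Phi> ^^ (q * j)) x" "- p * int j"]
    by (simp add: R_def funpow_add algebra_simps)
  define y' where "y' = y + of_int \<lceil>x - y\<rceil>"
  have y': "x \<le> y'" "y' < x + 1" unfolding y'_def by linarith+
  \<comment> \<open>The constant 2 in the hypothesis on \<open>J\<close> pays for the deviation 1
    and for the length 1 of the interval containing \<open>y'\<close>.\<close>
  have "R J \<ge> x + real J * \<delta> - 1"
    using rotation_number_deviation[OF rot, of "q * J" x] by (simp add: R_def \<delta> algebra_simps)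
  then have "y' < R J" using y' \<delta> by simp
  \<comment> \<open>The least index gives \<open>R j \<le> y' < R (Suc j)\<close> without showing
    that the sequence \<open>R\<close> increases.\<close>
  define k where "k = (LEAST k. y' < R k)"
  have k: "y' < R k" "k \<le> J" using LeastI[of "\<lambda>k. y' < R k" J] Least_le[of "\<lambda>k. y' < R k" J] \<open>y' < R J\<close>
    by (auto simp: k_def)
  have "k \<noteq> 0" using k y' by (intro notI) (simp add: R_def)
  then obtain j where j: "k = Suc j" using not0_implies_Suc by blast
  have xj: "R j \<le> y'" using not_less_Least[of j "\<lambda>k. y' < R k"] j by (simp add: k_def)
  define r where "r = q * j"
  \<comment> \<open>Modulo integers, \<open>R j\<close> is the point of index \<open>r\<close> on
    the orbit of \<open>x\<close>. Passing from \<open>x\<close> to \<open>R j\<close> only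
    exchanges \<open>r\<close> terms of the sum, each at cost at most \<open>V\<close>.\<close>
  have "S (R j) = (\<Sum>i<N. g ((\<Phi> ^^ (i + r)) x))"
    using S_shift[of "(\<Phi> ^^ r) x" "- p * int j"] by (simp add: S_def R_def r_def funpow_add)
  then have "S (R j) - S x = (\<Sum>i<r. g ((\<Phi> ^^ (N + i)) x) - g ((\<Phi> ^^ i) x))"
    using sum_lessThan_shift_diff[of "\<lambda>i. g ((\<Phi> ^^ i) x)" r N] by (simp add: S_def sum_subtractf)
  also have "\<bar>\<dots>\<bar> \<le> (\<Sum>i<r. V)"
    by (rule order_trans[OF sum_abs]) (intro sum_mono D)
  also have "\<dots> = V * r" by simp
  also have "\<dots> \<le> V * (real q * real J)"
    using k j D(5) by (intro mult_left_mono) (auto simp: r_def intro!: mult_left_mono)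
  finally have 1: "\<bar>S (R j) - S x\<bar> \<le> V * (real q * real J)" .
  define w where "w i = W ((\<Phi> ^^ i) (R j))" for i
  have "\<bar>S y' - S (R j)\<bar> = \<bar>\<Sum>i<N. g ((\<Phi> ^^ i) y') - g ((\<Phi> ^^ i) (R j))\<bar>"
    by (simp add: S_def sum_subtractf)
  also have "\<dots> \<le> (\<Sum>i<N. w (i + q) - of_int p * V - w i)"
  proof (rule order_trans[OF sum_abs], rule sum_mono)
    fix i
    have "(\<Phi> ^^ (i + q)) (R j) = (\<Phi> ^^ i) (R k) + of_int p"
      by (simp add: funpow_add R_Suc j iterate_shift_int)
    then have *: "w (i + q) = W ((\<Phi> ^^ i) (R k)) + of_int p * V"
      using quasi_periodic_int[of W V] D(2) by (simp add: w_def)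
    have "\<bar>g ((\<Phi> ^^ i) y') - g ((\<Phi> ^^ i) (R j))\<bar> \<le> W ((\<Phi> ^^ i) y') - w i"
      unfolding w_def by (intro D iterate_le xj)
    moreover have "W ((\<Phi> ^^ i) y') \<le> W ((\<Phi> ^^ i) (R k))"
      using k by (intro monoD[OF \<open>mono W\<close>] iterate_le) simp
    ultimately show "\<bar>g ((\<Phi> ^^ i) y') - g ((\<Phi> ^^ i) (R j))\<bar> \<le> w (i + q) - of_int p * V - w i"
      using * by simp
  qed
  also have "\<dots> = (\<Sum>i<q. w (N + i) - w i) - of_int p * V * N"
    using sum_lessThan_shift_diff[of w q N] by (simp add: sum_subtractf)
  \<comment> \<open>After telescoping, each of the \<open>q\<close> terms is the growth of
    \<open>W\<close> along \<open>N\<close> iterates: in units of \<open>V\<close>, this is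
    \<open>real N * \<rho>\<close> with error 1 from the rotation number and 1 from comparing
    \<open>W\<close> with its linear part. Subtracting the drift \<open>of_int p * V * N\<close>
    turns \<rho> into \<delta>.\<close>
  also have "(\<Sum>i<q. w (N + i) - w i) \<le> (\<Sum>i<q. V * (real N * \<rho> + 2))"
  proof (rule sum_mono)
    fix i
    define z where "z = (\<Phi> ^^ i) (R j)"
    have "w (N + i) - w i = W ((\<Phi> ^^ N) z) - W z" by (simp add: w_def z_def funpow_add)
    also have "\<dots> \<le> V * ((\<Phi> ^^ N) z - z) + V"
      using mono_quasi_periodic_deviation[of W V "(\<Phi> ^^ N) z" z] \<open>mono W\<close> D(2) by simp
    also have "\<dots> \<le> V * (real N * \<rho> + 1) + V"
      using rotation_number_deviation[OF rot, of N z] D(5) by (intro add_right_mono mult_left_mono) auto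
    finally show "w (N + i) - w i \<le> V * (real N * \<rho> + 2)" by (simp add: algebra_simps)
  qed
  finally have 2: "\<bar>S y' - S (R j)\<bar> \<le> V * (real N * \<delta> + 2 * real q)"
    by (simp add: \<delta> algebra_simps)
  have "S y' = S y" by (simp add: y'_def S_shift)
  with 1 2 have "\<bar>S y - S x\<bar> \<le> V * (real N * \<delta> + 2 * real q) + V * (real q * real J)" by linarith
  then show ?thesis unfolding S_def by (simp add: algebra_simps)
qed

text \<open>Of the three terms in the preceding bound only \<open>real N * \<delta>\<close> grows
  with \<open>N\<close>. Irrationality makes \<delta> positive and as small as desired. The numbers
  \<open>q\<close>, \<open>J\<close> and \<open>N\<close> are chosen from \<rho> and
  \<open>e\<close> alone, before any observable.\<close>

proposition (in circle_lift) uniform_birkhoff_oscillation: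
  assumes rot: "has_rotation_number \<Phi> \<rho>" and irr: "\<rho> \<notin> \<rat>" and "e > 0"
  obtains N where "N > 0"
    "\<And>g W V x y. dominated_variation g W V \<Longrightarrow>
       \<bar>(\<Sum>i<N. g ((\<Phi> ^^ i) y)) - (\<Sum>i<N. g ((\<Phi> ^^ i) x))\<bar> \<le> e * V * real N"
proof -
  \<comment> \<open>Approximating \<open>e / 4\<close> within \<open>e / 4\<close>, rather than 0,
    forces \<delta> to be positive.\<close>
  obtain h k where hk: "k > 0" "\<bar>of_int k * \<rho> - of_int h - e / 4\<bar> < e / 4"
    using sequence_of_fractional_parts_is_dense[OF irr, of "e / 4" "e / 4"] \<open>e > 0\<close>
    by (metis zero_less_divide_iff zero_less_numeral)
  define q where "q = nat k"
  define \<delta> where "\<delta> = real q * \<rho> - of_int h"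
  have \<delta>: "0 < \<delta>" "\<delta> < e / 2"
  proof -
    have "real q = of_int k" using hk by (simp add: q_def)
    then have "\<bar>\<delta> - e / 4\<bar> < e / 4" using hk(2) by (simp add: \<delta>_def)
    then show "0 < \<delta>" "\<delta> < e / 2" by linarith+
  qed
  obtain J :: nat where "2 / \<delta> \<le> real J" using real_arch_simple by blast
  then have J: "real J * \<delta> \<ge> 2" using \<delta> by (simp add: field_simps)
  have "\<forall>\<^sub>F N in sequentially. (2 * real q + real q * real J + 1) / real N < e / 2"
    using \<open>e > 0\<close> by (intro eventually_divide_of_nat_less) (auto intro!: add_nonneg_pos)
  with eventually_gt_at_top[of 0] have "\<forall>\<^sub>F N in sequentially. N > 0 \<and> 2 * real q + real q * real J \<le> e / 2 * real N"
    by eventually_elim (simp add: field_simps)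
  from eventually_happens'[OF sequentially_bot this] obtain N where N: "N > 0" "2 * real q + real q * real J \<le> e / 2 * real N"
    by blast
  show ?thesis
  proof (rule that[OF N(1)])
    fix g W V x y assume dom: "dominated_variation g W V"
    have "real N * \<delta> \<le> e / 2 * real N" using mult_left_mono[of \<delta> "e / 2" "real N"] \<delta> by (simp add: mult.commute)
    then have "V * (real N * \<delta> + 2 * real q + real q * real J) \<le> V * (e * real N)"
      using N(2) dominated_variationD(5)[OF dom] by (intro mult_left_mono) auto
    with birkhoff_oscillation_bound[OF rot dom \<delta>_def J]
    show "\<bar>(\<Sum>i<N. g ((\<Phi> ^^ i) y)) - (\<Sum>i<N. g ((\<Phi> ^^ i) x))\<bar> \<le> e * V * real N"
      by (rule order_trans[THEN order_trans[OF _ eq_refl]]) (simp add: algebra_simps)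
  qed
qed

section \<open>Weak limits of interspike-interval distributions\<close>

text \<open>The average of the block means over all starting points \<open>k < n\<close>, not only
  the multiples of \<open>N\<close>, is the mean of length \<open>n\<close> up to boundary terms.
  These and the finitely many early blocks contribute a bounded amount, which disappears after
  division by \<open>n\<close>.\<close>

lemma cesaro_of_block_means:
  fixes a :: "nat \<Rightarrow> real"
  assumes bdd: "\<And>i. \<bar>a i\<bar> \<le> B" and "N > 0" "e < e'"
    and blocks: "\<forall>\<^sub>F k in sequentially. \<bar>(\<Sum>i<N. a (k + i)) / real N - c\<bar> \<le> e"
  shows "\<forall>\<^sub>F n in sequentially. \<bar>(\<Sum>i<n. a i) / real n - c\<bar> < e'"
proof -
  define T where "T k = (\<Sum>i<N. a (k + i)) / real N - c" for k
  have "B \<ge> 0" using bdd[of 0] by linarith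
  obtain K where K: "\<And>k. k \<ge> K \<Longrightarrow> \<bar>T k\<bar> \<le> e"
    using blocks by (auto simp: T_def eventually_at_top_linorder)
  then have "e \<ge> 0" by force
  have T_le: "\<bar>T k\<bar> \<le> e + (B + \<bar>c\<bar>)" for k
  proof -
    have "\<bar>\<Sum>i<N. a (k + i)\<bar> \<le> (\<Sum>i<N. B)"
      by (rule order_trans[OF sum_abs]) (intro sum_mono bdd)
    then have "\<bar>(\<Sum>i<N. a (k + i)) / real N\<bar> \<le> B"
      using \<open>N > 0\<close> by (simp add: abs_divide field_simps)
    then show ?thesis using \<open>e \<ge> 0\<close> unfolding T_def by linarith
  qed
  have sum_T: "\<bar>\<Sum>k<n. T k\<bar> \<le> real n * e + real K * (B + \<bar>c\<bar>)" for n
  proof -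
    have "\<bar>\<Sum>k<n. T k\<bar> \<le> (\<Sum>k<n. e + (if k < K then B + \<bar>c\<bar> else 0))"
      using T_le K by (intro order_trans[OF sum_abs] sum_mono) (auto simp: not_less)
    also have "\<dots> = real n * e + real (card ({..<n} \<inter> {k. k < K})) * (B + \<bar>c\<bar>)"
      by (simp add: sum.distrib flip: sum.inter_restrict[of _ _ "{k. k < K}", simplified])
    also have "\<dots> \<le> real n * e + real K * (B + \<bar>c\<bar>)"
      using card_mono[of "{..<K}" "{..<n} \<inter> {k. k < K}"] \<open>B \<ge> 0\<close>
      by (intro add_left_mono mult_right_mono) auto
    finally show ?thesis .
  qed
  \<comment> \<open>Interchanging the sums gives \<open>N\<close> copies of the sum of
    \<open>a\<close> over \<open>{..<n}\<close>, each shifted by some \<open>i < N\<close>, and a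
    shift by \<open>i\<close> exchanges \<open>i\<close> terms at either end.\<close>
  have swap: "\<bar>(\<Sum>k<n. T k) - ((\<Sum>i<n. a i) - real n * c)\<bar> \<le> 2 * real N * B" for n
  proof -
    define A where "A = (\<Sum>i<n. a i)"
    have "(\<Sum>k<n. \<Sum>i<N. a (k + i)) = (\<Sum>i<N. \<Sum>k<n. a (k + i))" by (rule sum.swap)
    then have "(\<Sum>k<n. T k) = (\<Sum>i<N. \<Sum>k<n. a (k + i)) / real N - real n * c"
      by (simp add: T_def sum_subtractf flip: sum_divide_distrib)
    also have "(\<Sum>i<N. \<Sum>k<n. a (k + i)) = (\<Sum>i<N. A + ((\<Sum>k<i. a (n + k)) - (\<Sum>k<i. a k)))"
      using sum_lessThan_shift_diff[of a _ n] by (intro sum.cong refl) (simp add: A_def algebra_simps)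
    also have "\<dots> = real N * A + (\<Sum>i<N. (\<Sum>k<i. a (n + k)) - (\<Sum>k<i. a k))"
      by (simp add: sum.distrib)
    finally have "(\<Sum>k<n. T k) - (A - real n * c) = (\<Sum>i<N. (\<Sum>k<i. a (n + k)) - (\<Sum>k<i. a k)) / real N"
      using \<open>N > 0\<close> by (simp add: field_simps)
    moreover have "\<bar>\<Sum>i<N. (\<Sum>k<i. a (n + k)) - (\<Sum>k<i. a k)\<bar> \<le> (\<Sum>i<N. 2 * real N * B)"
    proof (rule order_trans[OF sum_abs], rule sum_mono)
      fix i assume i: "i \<in> {..<N}"
      have "\<bar>\<Sum>k<i. a (n + k)\<bar> \<le> (\<Sum>k<i. B)" "\<bar>\<Sum>k<i. a k\<bar> \<le> (\<Sum>k<i. B)"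
        by (rule order_trans[OF sum_abs], intro sum_mono bdd)+
      moreover have "(\<Sum>k<i. B) \<le> real N * B"
        using i \<open>B \<ge> 0\<close> by (simp add: mult_right_mono)
      ultimately show "\<bar>(\<Sum>k<i. a (n + k)) - (\<Sum>k<i. a k)\<bar> \<le> 2 * real N * B" by linarith
    qed
    ultimately show ?thesis
      using \<open>N > 0\<close> by (simp add: A_def abs_divide divide_le_eq mult.commute)
  qed
  define C where "C = 2 * real N * B + real K * (B + \<bar>c\<bar>) + 1"
  have "C > 0" using \<open>B \<ge> 0\<close> by (simp add: C_def add_nonneg_pos)
  then have "\<forall>\<^sub>F n in sequentially. C / real n < e' - e"
    using \<open>e < e'\<close> by (intro eventually_divide_of_nat_less) auto
  with eventually_gt_at_top[of 0] show ?thesis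
  proof eventually_elim
    case (elim n)
    have "\<bar>(\<Sum>i<n. a i) - real n * c\<bar> \<le> real n * e + C" using sum_T[of n] swap[of n] by (simp add: C_def)
    moreover have "(\<Sum>i<n. a i) / real n - c = ((\<Sum>i<n. a i) - real n * c) / real n"
      using elim by (simp add: field_simps)
    ultimately have "\<bar>(\<Sum>i<n. a i) / real n - c\<bar> \<le> (real n * e + C) / real n"
      using elim by (simp add: abs_divide divide_right_mono)
    also have "\<dots> = e + C / real n" using elim by (simp add: field_simps)
    finally show ?case using elim by simp
  qed
qed

lemma eventually_all_residues:
  assumes "q > 0" "\<And>j. j < q \<Longrightarrow> \<forall>\<^sub>F k in sequentially. P (q * k + j)"
  shows "\<forall>\<^sub>F n in sequentially. P (n :: nat)"
proof -
  have "\<forall>\<^sub>F k in sequentially. \<forall>j\<in>{..<q}. P (q * k + j)"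
    using assms(2) by (intro eventually_ball_finite) auto
  then have "\<forall>\<^sub>F n in sequentially. \<forall>j\<in>{..<q}. P (q * (n div q) + j)"
    using filterlim_at_top_div_const_nat[OF assms(1)] by (rule eventually_compose_filterlim)
  then show ?thesis
    by eventually_elim (use assms(1) in \<open>metis lessThan_iff mod_less_divisor mult_div_mod_eq\<close>)
qed

section \<open>Weak convergence from Lipschitz test functions\<close>

lemma real_distribution_empirical_isi:
  assumes "n > 0" shows "real_distribution (empirical_isi \<Phi> t n)"
proof -
  interpret prob_space "uniform_count_measure {..<n}"
    using assms by (intro prob_space_uniform_count_measure) auto
  show ?thesis unfolding empirical_isi_def real_distribution_def real_distribution_axioms_def
    by (auto intro!: prob_space_distr)
qed

lemma integral_empirical_isi:
  assumes [measurable]: "h \<in> borel_measurable borel"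
  shows "integral\<^sup>L (empirical_isi \<Phi> t n) h = (\<Sum>i<n. h ((\<Phi> ^^ Suc i) t - (\<Phi> ^^ i) t)) / real n"
  unfolding empirical_isi_def
  by (subst integral_distr) (auto simp: integral_uniform_count_measure)

lemma lipschitz_cts_step:
  assumes "x < y" shows "(1 / (y - x))-lipschitz_on UNIV (cts_step x y)"
proof (rule lipschitz_onI)
  fix a b :: real
  have "cts_step x y u = max 0 (min 1 ((y - u) / (y - x)))" for u
    using assms by (auto simp: cts_step_def field_simps)
  moreover have "\<bar>(y - a) / (y - x) - (y - b) / (y - x)\<bar> = 1 / (y - x) * \<bar>a - b\<bar>"
    using assms by (simp add: abs_divide abs_minus_commute flip: diff_divide_distrib)
  ultimately show "dist (cts_step x y a) (cts_step x y b) \<le> 1 / (y - x) * dist a b"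
    by (simp add: dist_real_def)
qed (use assms in auto)

text \<open>Continuous step functions are enough to detect weak convergence on the line, and they
  are Lipschitz, the class for which Birkhoff means are controlled.\<close>

lemma weak_conv_empirical_isi:
  assumes "real_distribution \<nu>"
    and conv: "\<And>h L. L-lipschitz_on UNIV h \<Longrightarrow>
      (\<lambda>n. (\<Sum>i<n. h ((\<Phi> ^^ Suc i) t - (\<Phi> ^^ i) t)) / real n) \<longlonglongrightarrow> integral\<^sup>L \<nu> h"
  shows "weak_conv_m (empirical_isi \<Phi> t) \<nu>"
proof -
  \<comment> \<open>For \<open>n = 0\<close> the empirical measure is not a probability measure, so
    the sequence is started at 1.\<close>
  have "weak_conv_m (\<lambda>n. empirical_isi \<Phi> t (Suc n)) \<nu>"
  proof (rule integral_cts_step_conv_imp_weak_conv)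
    fix x y :: real assume "x < y"
    have "(\<lambda>n. integral\<^sup>L (empirical_isi \<Phi> t n) (cts_step x y)) \<longlonglongrightarrow> integral\<^sup>L \<nu> (cts_step x y)"
      using conv[OF lipschitz_cts_step[OF \<open>x < y\<close>]]
      by (subst integral_empirical_isi)
        (auto intro: borel_measurable_continuous_onI lipschitz_on_continuous_on lipschitz_cts_step[OF \<open>x < y\<close>])
    then show "(\<lambda>n. integral\<^sup>L (empirical_isi \<Phi> t (Suc n)) (cts_step x y)) \<longlonglongrightarrow> integral\<^sup>L \<nu> (cts_step x y)"
      by (rule LIMSEQ_Suc)
  qed (use assms real_distribution_empirical_isi in auto)
  then show ?thesis
    unfolding weak_conv_m_def weak_conv_def by (auto intro: LIMSEQ_imp_Suc)
qed

section \<open>Interspike intervals as an observable; rational rotation numbers\<close>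

context circle_lift
begin

lemma displacement_bounds: "\<Phi> x - x \<in> {\<Phi> 0 - 1..\<Phi> 0 + 1}"
  using iterate_deviation[of 1 x 0] by (simp add: abs_le_iff)

text \<open>The displacement is the difference of two increasing functions, \<Phi> and the identity,
  so its variation is at most the growth of their sum, which is 2 over a period.\<close>

lemma dominated_lipschitz_displacement:
  assumes "L-lipschitz_on UNIV h"
  shows "dominated_variation (\<lambda>x. h (\<Phi> x - x)) (\<lambda>x. L * (\<Phi> x + x)) (2 * L)"
  unfolding dominated_variation_def
proof (intro conjI allI impI)
  fix x y :: real assume "x \<le> y"
  have "\<bar>h (\<Phi> y - y) - h (\<Phi> x - x)\<bar> \<le> L * \<bar>(\<Phi> y - y) - (\<Phi> x - x)\<bar>"
    using lipschitz_onD[OF assms, of "\<Phi> y - y" "\<Phi> x - x"] by (simp add: dist_real_def)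
  also have "\<dots> \<le> L * ((\<Phi> y + y) - (\<Phi> x + x))"
    using \<open>x \<le> y\<close> iterate_le[of x y 1] lipschitz_on_nonneg[OF assms] by (intro mult_left_mono) auto
  finally show "\<bar>h (\<Phi> y - y) - h (\<Phi> x - x)\<bar> \<le> L * (\<Phi> y + y) - L * (\<Phi> x + x)"
    by (simp add: algebra_simps)
qed (auto simp: shift algebra_simps)

lemma empirical_isi_bounds:
  assumes "n > 0" "\<And>x. \<Phi> x - x \<in> {a..b}"
  shows "measure (empirical_isi \<Phi> t n) {a..b} = 1"
proof -
  have "(\<lambda>i. (\<Phi> ^^ Suc i) t - (\<Phi> ^^ i) t) -` {a..b} \<inter> {..<n} = {..<n}"
    using assms(2) by auto
  then show ?thesis using assms(1)
    unfolding empirical_isi_def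
    by (subst measure_distr) (auto simp: space_uniform_count_measure measure_uniform_count_measure simp del: funpow.simps)
qed

lemma lipschitz_displacement_bounded:
  fixes h :: "real \<Rightarrow> real"
  assumes "L-lipschitz_on UNIV h"
  obtains B where "\<And>x. \<bar>h (\<Phi> x - x)\<bar> \<le> B"
proof
  fix x
  show "\<bar>h (\<Phi> x - x)\<bar> \<le> \<bar>h (\<Phi> 0 - 0)\<bar> + 2 * L"
    using dominated_variationD(6)[OF dominated_lipschitz_displacement[OF assms], of x 0] by linarith
qed

text \<open>The limit is the empirical distribution over one period of the periodic point
  \<open>L\<close> that attracts the run.\<close>

lemma isi_convergence_rational:
  assumes rot: "has_rotation_number \<Phi> \<rho>" and rat: "\<rho> \<in> \<rat>"
  obtains L q where "q > 0" "\<And>h. continuous_on UNIV h \<Longrightarrow>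
      (\<lambda>n. (\<Sum>i<n. h ((\<Phi> ^^ Suc i) t - (\<Phi> ^^ i) t)) / real n)
        \<longlonglongrightarrow> integral\<^sup>L (empirical_isi \<Phi> L q) h"
proof -
  obtain p q' where pq': "q' > 0" "\<rho> = of_int p / of_int q'" using rat by (meson Rats_cases')
  define q where "q = nat q'"
  have q: "q > 0" "real q * \<rho> = of_int p" using pq' by (auto simp: q_def)
  define R where "R k = (\<Phi> ^^ (q * k)) t - of_int p * real k" for k
  have R_Suc: "R (Suc k) = (\<Phi> ^^ q) (R k) - of_int p" for k
    using iterate_shift_int[of q "(\<Phi> ^^ (q * k)) t" "- p * int k"]
    by (simp add: R_def funpow_add algebra_simps)
  \<comment> \<open>Since \<open>real q * \<rho>\<close> is the integer \<open>p\<close>, the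
    deviation bound keeps the orbit of \<open>\<Phi>\<^sup>q - p\<close> near
    \<open>t\<close>.\<close>
  have "\<bar>R k - t\<bar> \<le> 1" for k
    using rotation_number_deviation[OF rot, of "q * k" t] q by (simp add: R_def algebra_simps flip: q(2))
  then have "R k \<in> {t - 1..t + 1}" for k by (simp add: abs_le_iff) (smt (verit))
  then have bdd: "bounded (range R)" by (intro bounded_subset[OF bounded_closed_interval[of "t - 1" "t + 1"]]) auto
  \<comment> \<open>A monotone map preserves the direction of the first step of an orbit.\<close>
  have "monoseq R"
  proof (cases "R 0 \<le> R 1")
    case True
    have "R k \<le> R (Suc k)" for k
      by (induction k) (use True iterate_le[of _ _ q] R_Suc in \<open>auto\<close>)
    then show ?thesis by (simp add: monoseq_Suc)
  next
    case False
    have "R k \<ge> R (Suc k)" for k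
      by (induction k) (use False iterate_le[of _ _ q] R_Suc in \<open>auto\<close>)
    then show ?thesis by (simp add: monoseq_Suc)
  qed
  then obtain L where L: "R \<longlonglongrightarrow> L"
    using Bseq_monoseq_convergent bdd convergentD by (metis Bseq_eq_bounded)
  have isC: "isCont (\<Phi> ^^ j) x" for j x
    using iterate_cont by (simp add: continuous_on_eq_continuous_at)
  have "(\<lambda>k. R (Suc k)) \<longlonglongrightarrow> (\<Phi> ^^ q) L - of_int p"
    unfolding R_Suc by (intro tendsto_intros isCont_tendsto_compose[OF isC] L)
  from LIMSEQ_unique[OF this LIMSEQ_Suc[OF L]] have fix_L: "(\<Phi> ^^ q) L = L + of_int p"
    by simp
  show ?thesis
  proof (rule that[OF \<open>q > 0\<close>])
    fix h :: "real \<Rightarrow> real" assume h: "continuous_on UNIV h"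
    define g where "g x = h (\<Phi> x - x)" for x
    define \<tau> where "\<tau> x = (\<Sum>i<q. g ((\<Phi> ^^ i) x)) / real q" for x
    have g_cont: "continuous_on UNIV g"
      unfolding g_def by (intro continuous_on_compose2[OF h] continuous_intros cont) auto
    have \<tau>_cont: "isCont \<tau> x" for x
    proof -
      have "continuous_on UNIV \<tau>"
        unfolding \<tau>_def using q(1)
        by (intro continuous_intros continuous_on_compose2[OF g_cont iterate_cont]) auto
      then show ?thesis by (simp add: continuous_on_eq_continuous_at)
    qed
    have g_shift: "g (x + of_int m) = g x" for x m
      by (simp add: g_def iterate_shift_int[of 1, simplified])
    have \<tau>_shift: "\<tau> (x + of_int m) = \<tau> x" for x m
      by (simp add: \<tau>_def iterate_shift_int g_shift)
    \<comment> \<open>The mean over a full period does not depend on the starting point: moving the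
      start by one drops a term and adds an equal one.\<close>
    have \<tau>_orbit: "\<tau> ((\<Phi> ^^ j) L) = \<tau> L" for j
    proof (induction j)
      case (Suc j)
      have "(\<Phi> ^^ q) ((\<Phi> ^^ j) L) = (\<Phi> ^^ j) L + of_int p"
        using fix_L by (metis add.commute comp_apply funpow_add iterate_shift_int)
      then have "(\<Sum>i<q. g ((\<Phi> ^^ Suc i) ((\<Phi> ^^ j) L))) = (\<Sum>i<q. g ((\<Phi> ^^ i) ((\<Phi> ^^ j) L)))"
        using sum.lessThan_Suc_shift[of "\<lambda>i. g ((\<Phi> ^^ i) ((\<Phi> ^^ j) L))" q] g_shift by simp
      then have "\<tau> ((\<Phi> ^^ Suc j) L) = \<tau> ((\<Phi> ^^ j) L)"
        by (simp add: \<tau>_def funpow_swap1)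
      with Suc show ?case by simp
    qed simp
    obtain B where B: "\<And>x. \<bar>g x\<bar> \<le> B"
    proof -
      have "compact (h ` {\<Phi> 0 - 1..\<Phi> 0 + 1})"
        by (intro compact_continuous_image continuous_on_subset[OF h]) auto
      then obtain B where "\<And>y. y \<in> h ` {\<Phi> 0 - 1..\<Phi> 0 + 1} \<Longrightarrow> norm y \<le> B"
        using compact_imp_bounded bounded_iff by metis
      then show ?thesis using that displacement_bounds by (force simp: g_def)
    qed
    \<comment> \<open>Along each residue class \<open>j\<close> the run approaches
      \<open>(\<Phi> ^^ j) L\<close> modulo integers. As \<tau> agrees at all these points, it
      converges along the whole run, although the run modulo integers need not.\<close>
    have \<tau>_lim: "(\<lambda>n. \<tau> ((\<Phi> ^^ n) t)) \<longlonglongrightarrow> \<tau> L"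
    proof (rule tendstoI, rule eventually_all_residues[OF \<open>q > 0\<close>])
      fix e :: real and j assume "e > 0"
      have "(\<lambda>k. \<tau> ((\<Phi> ^^ j) (R k))) \<longlonglongrightarrow> \<tau> ((\<Phi> ^^ j) L)"
        by (intro isCont_tendsto_compose[OF \<tau>_cont] isCont_tendsto_compose[OF isC] L)
      moreover have "\<tau> ((\<Phi> ^^ j) (R k)) = \<tau> ((\<Phi> ^^ (q * k + j)) t)" for k
        using \<tau>_shift iterate_shift_int[of j "(\<Phi> ^^ (q * k)) t" "- p * int k"]
          \<tau>_shift[of "(\<Phi> ^^ (q * k + j)) t" "- p * int k"]
        by (simp add: R_def funpow_add add.commute[of _ j])
      ultimately have "(\<lambda>k. \<tau> ((\<Phi> ^^ (q * k + j)) t)) \<longlonglongrightarrow> \<tau> L" using \<tau>_orbit by simp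
      then show "\<forall>\<^sub>F k in sequentially. dist (\<tau> ((\<Phi> ^^ (q * k + j)) t)) (\<tau> L) < e"
        using \<open>e > 0\<close> by (rule tendstoD)
    qed
    have "(\<lambda>n. (\<Sum>i<n. g ((\<Phi> ^^ i) t)) / real n) \<longlonglongrightarrow> \<tau> L"
    proof (rule tendstoI)
      fix e :: real assume "e > 0"
      have "\<forall>\<^sub>F k in sequentially. \<bar>(\<Sum>i<q. g ((\<Phi> ^^ (k + i)) t)) / real q - \<tau> L\<bar> \<le> e / 2"
        using tendstoD[OF \<tau>_lim half_gt_zero[OF \<open>e > 0\<close>]]
      proof eventually_elim
        case (elim k)
        have "(\<Phi> ^^ (k + i)) t = (\<Phi> ^^ i) ((\<Phi> ^^ k) t)" for i
          by (metis add.commute comp_apply funpow_add)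
        then show ?case using elim by (simp add: \<tau>_def dist_real_def)
      qed
      from cesaro_of_block_means[OF B \<open>q > 0\<close> _ this, of e] \<open>e > 0\<close>
      show "\<forall>\<^sub>F n in sequentially. dist ((\<Sum>i<n. g ((\<Phi> ^^ i) t)) / real n) (\<tau> L) < e"
        by (simp add: dist_real_def)
    qed
    moreover have "integral\<^sup>L (empirical_isi \<Phi> L q) h = \<tau> L"
      by (subst integral_empirical_isi) (auto simp: \<tau>_def g_def intro: borel_measurable_continuous_onI h)
    ultimately show "(\<lambda>n. (\<Sum>i<n. h ((\<Phi> ^^ Suc i) t - (\<Phi> ^^ i) t)) / real n)
        \<longlonglongrightarrow> integral\<^sup>L (empirical_isi \<Phi> L q) h" by (simp add: g_def)
  qed
qed

end

section \<open>Invariant measures\<close>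

lemma borel_measurable_frac[measurable]: "(frac :: real \<Rightarrow> real) \<in> borel_measurable borel"
  unfolding frac_def by measurable

lemma distr_rotation_uniform:
  "distr (restrict_space lborel {0..<1}) (restrict_space borel {0..<1}) (\<lambda>s. frac (s + r)) =
     restrict_space lborel {0..<1 :: real}" (is "distr ?U ?B _ = _")
proof (rule measure_eqI)
  have meas: "(\<lambda>s. frac (s + r)) \<in> measurable ?U ?B"
    by (intro measurable_restrict_space2 measurable_restrict_space1)
      (auto simp: frac_lt_1)
  fix A assume "A \<in> sets (distr ?U ?B (\<lambda>s. frac (s + r)))"
  then have A: "A \<in> sets borel" "A \<subseteq> {0..<1}" by (auto simp: sets_restrict_space_iff)
  define c where "c = frac r"
  have c: "0 \<le> c" "c < 1" by (auto simp: c_def frac_lt_1)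
  have frac_c: "frac (s + r) = (if s + c < 1 then s + c else s + c - 1)" if "0 \<le> s" "s < 1" for s
    using that by (simp add: frac_add[of s r] c_def frac_eq[THEN iffD2])
  have transl: "emeasure lborel ((\<lambda>s. d + s) -` X) = emeasure lborel X" if "X \<in> sets borel" for d :: real and X
    using emeasure_distr[of "(+) d" lborel borel X] that by (simp add: lborel_distr_plus)
  have "emeasure (distr ?U ?B (\<lambda>s. frac (s + r))) A = emeasure ?U ((\<lambda>s. frac (s + r)) -` A \<inter> {0..<1})"
    using A meas by (subst emeasure_distr) (auto simp: sets_restrict_space_iff)
  also have "\<dots> = emeasure lborel ((\<lambda>s. frac (s + r)) -` A \<inter> {0..<1})"
    by (subst emeasure_restrict_space) auto
  \<comment> \<open>The preimage consists of the points that stay below 1 and of those that wrap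
    around, each a translate of a part of \<open>A\<close>.\<close>
  also have "(\<lambda>s. frac (s + r)) -` A \<inter> {0..<1} = (\<lambda>s. c + s) -` (A \<inter> {c..<1}) \<union> (\<lambda>s. (c - 1) + s) -` (A \<inter> {0..<c})"
    using c A(2) by (auto simp: frac_c algebra_simps split: if_splits)
  also have "emeasure lborel \<dots> = emeasure lborel ((\<lambda>s. c + s) -` (A \<inter> {c..<1})) + emeasure lborel ((\<lambda>s. (c - 1) + s) -` (A \<inter> {0..<c}))"
    using A by (intro plus_emeasure[symmetric]) (auto intro!: measurable_sets_borel[where A = borel])
  also have "\<dots> = emeasure lborel (A \<inter> {c..<1}) + emeasure lborel (A \<inter> {0..<c})"
    using A by (simp only: transl sets.Int borel_closed atLeastLessThan_borel)
  also have "\<dots> = emeasure lborel ((A \<inter> {c..<1}) \<union> (A \<inter> {0..<c}))"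
    using A by (intro plus_emeasure) auto
  also have "(A \<inter> {c..<1}) \<union> (A \<inter> {0..<c}) = A" using A(2) c by auto
  also have "emeasure lborel A = emeasure ?U A"
    using A by (subst emeasure_restrict_space) auto
  finally show "emeasure (distr ?U ?B (\<lambda>s. frac (s + r))) A = emeasure ?U A" .
qed (simp add: sets_restrict_space)

section \<open>Semiconjugacy to a translation and existence of an invariant measure\<close>

context circle_lift
begin

lemma surj: "\<exists>x. \<Phi> x = y"
proof -
  define a b where "a = y - \<Phi> 0 - 2" "b = y - \<Phi> 0 + 2"
  have "\<Phi> a \<le> y" "y \<le> \<Phi> b" "a \<le> b"
    using iterate_deviation[of 1 a 0] iterate_deviation[of 1 b 0] by (auto simp: a_b_def abs_le_iff)
  from IVT'[OF this] show ?thesis using continuous_on_subset[OF cont] by auto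
qed

lemma measurable_lift[measurable]: "\<Phi> \<in> borel_measurable borel"
  using cont by (rule borel_measurable_continuous_onI)

lemma measurable_iterate[measurable]: "(\<Phi> ^^ n) \<in> borel_measurable borel"
  using iterate_cont by (rule borel_measurable_continuous_onI)

lemma measurable_circle_map: "(\<lambda>t. frac (\<Phi> t)) \<in> measurable (restrict_space borel {0..<1}) (restrict_space borel {0..<1})"
  by (intro measurable_restrict_space2 measurable_restrict_space1) (auto simp: frac_lt_1)

text \<open>The inverse of \<open>G\<close> is a semiconjugacy of \<open>\<Phi>\<close> to the translation by \<open>\<rho>\<close>. Working with \<open>G\<close>
  itself has the advantage that an invariant measure is obtained by pushing forward Lebesgue measure.\<close>

lemma ex_translation_conjugacy:
  assumes rot: "has_rotation_number \<Phi> \<rho>"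
  obtains G where "mono G" "\<And>s. G (s + 1) = G s + 1" "\<And>s. G (s + \<rho>) = \<Phi> (G s)"
proof -
  \<comment> \<open>These are the points whose orbit is eventually below the orbit of
    \<open>s\<close> under the translation by \<rho>. With "eventually" in place of a bound for all
    \<open>n\<close>, dropping the first iterate changes nothing, so \<open>S (s + \<rho>)\<close>
    is exactly the image of \<open>S s\<close>.\<close>
  define S where "S s = {x. \<forall>\<^sub>F n in sequentially. (\<Phi> ^^ n) x \<le> s + real n * \<rho>}" for s
  define G where "G s = Sup (S s)" for s
  note dev = rotation_number_deviation[OF rot]
  have upper: "x \<le> s + 1" if x: "x \<in> S s" for x s
  proof -
    obtain n where "(\<Phi> ^^ n) x \<le> s + real n * \<rho>"
      using eventually_happens'[OF sequentially_bot] x unfolding S_def by blast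
    then show ?thesis using dev[of n x] by (simp add: abs_le_iff)
  qed
  have "s - 1 \<in> S s" for s
  proof -
    have "(\<Phi> ^^ n) (s - 1) \<le> s + real n * \<rho>" for n
      using dev[of n "s - 1"] by (simp add: abs_le_iff)
    then show ?thesis by (simp add: S_def)
  qed
  then have ne: "S s \<noteq> {}" for s by blast
  have bdd: "bdd_above (S s)" for s using upper by (rule bdd_aboveI)
  \<comment> \<open>Monotone continuous maps commute with suprema. Applied to the unit translation
    and to \<Phi>, this carries the equalities between the sets over to \<open>G\<close>.\<close>
  have image: "f (G s) = Sup (f ` S s)" if "mono f" "continuous_on UNIV f" for f :: "real \<Rightarrow> real" and s
    unfolding G_def
    using that by (intro continuous_at_Sup_mono ne bdd)
      (auto simp: continuous_on_eq_continuous_at intro: continuous_at_imp_continuous_at_within)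
  show ?thesis
  proof
    show "mono G"
    proof
      fix s s' :: real assume "s \<le> s'"
      then have "S s \<subseteq> S s'" unfolding S_def by (auto elim!: eventually_mono)
      then show "G s \<le> G s'" unfolding G_def by (intro cSup_subset_mono ne bdd)
    qed
    fix s
    have "S (s + 1) = (\<lambda>x. x + 1) ` S s"
    proof safe
      fix x assume "x \<in> S (s + 1)"
      then have "\<forall>\<^sub>F n in sequentially. (\<Phi> ^^ n) x \<le> s + 1 + real n * \<rho>" by (simp add: S_def)
      then have "\<forall>\<^sub>F n in sequentially. (\<Phi> ^^ n) (x - 1) \<le> s + real n * \<rho>"
      proof eventually_elim
        case (elim n)
        then show ?case using iterate_shift[of n "x - 1"] by simp
      qed
      then have "x - 1 \<in> S s" by (simp add: S_def)
      then show "x \<in> (\<lambda>x. x + 1) ` S s" by (intro image_eqI[of _ _ "x - 1"]) simp_all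
    qed (simp add: S_def iterate_shift)
    then show "G (s + 1) = G s + 1"
      using image[of "\<lambda>x. x + 1" s] by (simp add: G_def monoI continuous_intros)
    have S_image: "\<Phi> x \<in> S (s + \<rho>) \<longleftrightarrow> x \<in> S s" for x
    proof -
      have "\<Phi> x \<in> S (s + \<rho>) \<longleftrightarrow> (\<forall>\<^sub>F n in sequentially. (\<Phi> ^^ Suc n) x \<le> s + real (Suc n) * \<rho>)"
        by (simp add: S_def funpow_swap1 algebra_simps)
      also have "\<dots> \<longleftrightarrow> x \<in> S s" unfolding S_def mem_Collect_eq by (rule eventually_sequentially_Suc)
      finally show ?thesis .
    qed
    have "S (s + \<rho>) = \<Phi> ` S s"
    proof safe
      fix y assume "y \<in> S (s + \<rho>)"
      moreover obtain x where "y = \<Phi> x" using surj by metis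
      ultimately show "y \<in> \<Phi> ` S s" using S_image by blast
    qed (simp add: S_image)
    then show "G (s + \<rho>) = \<Phi> (G s)"
      using image[OF strict_mono_mono[OF smono] cont, of s] by (simp add: G_def)
  qed
qed

lemma ex_invariant_measure: "\<exists>\<mu>. circle_invariant_measure \<Phi> \<mu>"
proof -
  obtain \<rho> where rot: "has_rotation_number \<Phi> \<rho>" using ex_rotation_number by blast
  obtain G where G: "mono G" "\<And>s. G (s + 1) = G s + 1" "\<And>s. G (s + \<rho>) = \<Phi> (G s)"
    using ex_translation_conjugacy[OF rot] by metis
  have [measurable]: "G \<in> borel_measurable borel" using borel_measurable_mono[OF G(1)] .
  let ?U = "restrict_space lborel {0..<1 :: real}" and ?B = "restrict_space borel {0..<1 :: real}"
  define \<gamma> where "\<gamma> s = frac (G s)" for s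
  have \<gamma>: "\<gamma> \<in> measurable ?U ?B" "\<gamma> \<in> measurable ?B ?B"
    unfolding \<gamma>_def
    by (auto simp: frac_lt_1 intro!: measurable_restrict_space2 measurable_restrict_space1)
  have rotm: "(\<lambda>s. frac (s + \<rho>)) \<in> measurable ?U ?B"
    by (intro measurable_restrict_space2 measurable_restrict_space1) (auto simp: frac_lt_1)
  interpret U: prob_space ?U
    by standard (simp add: emeasure_restrict_space)
  define \<mu> where "\<mu> = distr ?U ?B \<gamma>"
  \<comment> \<open>This is the semiconjugacy on the circle. Since rotations preserve the uniform
    distribution, its image under \<gamma> is invariant.\<close>
  have conj: "frac (\<Phi> (\<gamma> s)) = \<gamma> (frac (s + \<rho>))" for s
  proof -
    have "frac (\<Phi> (\<gamma> s)) = frac (\<Phi> (G s))"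
      unfolding \<gamma>_def by (rule frac_quasi_periodic) (simp add: shift frac_def)
    also have "\<dots> = \<gamma> (frac (s + \<rho>))"
      unfolding \<gamma>_def G(3)[symmetric] by (rule frac_quasi_periodic[symmetric]) (simp add: G(2) frac_def)
    finally show ?thesis .
  qed
  have \<mu>_sets: "sets \<mu> = sets ?B" by (simp add: \<mu>_def)
  have "distr \<mu> \<mu> (\<lambda>t. frac (\<Phi> t)) = distr \<mu> ?B (\<lambda>t. frac (\<Phi> t))"
    by (rule distr_cong) (simp_all add: \<mu>_sets)
  also have "\<dots> = distr ?U ?B (\<lambda>s. frac (\<Phi> (\<gamma> s)))"
    unfolding \<mu>_def by (subst distr_distr[OF measurable_circle_map \<gamma>(1)]) (simp add: o_def)
  also have "\<dots> = distr (distr ?U ?B (\<lambda>s. frac (s + \<rho>))) ?B \<gamma>"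
    by (subst distr_distr[OF \<gamma>(2) rotm]) (simp add: o_def conj)
  also have "\<dots> = \<mu>" by (simp add: distr_rotation_uniform \<mu>_def)
  finally have "distr \<mu> \<mu> (\<lambda>t. frac (\<Phi> t)) = \<mu>" .
  moreover have "prob_space \<mu>" unfolding \<mu>_def by (rule U.prob_space_distr[OF \<gamma>(1)])
  moreover have "(\<lambda>t. frac (\<Phi> t)) \<in> measurable \<mu> \<mu>"
    using measurable_circle_map measurable_cong_sets[OF \<mu>_sets \<mu>_sets] by blast
  ultimately show ?thesis using \<mu>_sets unfolding circle_invariant_measure_def by blast
qed

section \<open>Birkhoff means and uniqueness of the invariant measure\<close>

lemma invariant_measure_integral_iterate:
  assumes inv: "circle_invariant_measure \<Phi> \<mu>"
    and [measurable]: "g \<in> borel_measurable borel" and per: "\<And>x. g (x + 1) = g x"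
  shows "(LINT x|\<mu>. g ((\<Phi> ^^ n) x)) = (LINT x|\<mu>. g x :: real)"
proof (induction n)
  case (Suc n)
  have sets: "sets \<mu> = sets (restrict_space borel {0..<1})"
    and T: "(\<lambda>t. frac (\<Phi> t)) \<in> measurable \<mu> \<mu>" "distr \<mu> \<mu> (\<lambda>t. frac (\<Phi> t)) = \<mu>"
    using inv by (auto simp: circle_invariant_measure_def)
  have meas: "(\<lambda>x. g ((\<Phi> ^^ n) x)) \<in> borel_measurable \<mu>"
    unfolding measurable_cong_sets[OF sets refl] by (intro measurable_restrict_space1) simp
  have "(LINT x|\<mu>. g ((\<Phi> ^^ n) x)) = (LINT x|distr \<mu> \<mu> (\<lambda>t. frac (\<Phi> t)). g ((\<Phi> ^^ n) x))"
    by (simp add: T)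
  also have "\<dots> = (LINT x|\<mu>. g ((\<Phi> ^^ n) (frac (\<Phi> x))))"
    by (rule integral_distr[OF T(1) meas])
  also have "\<dots> = (LINT x|\<mu>. g ((\<Phi> ^^ Suc n) x))"
    using frac_quasi_periodic[of "\<lambda>x. g ((\<Phi> ^^ n) x)"] by (simp add: iterate_shift per funpow_swap1)
  finally show ?case using Suc by simp
qed simp

text \<open>Integrating the oscillation bound in \<open>x\<close> compares the Birkhoff sum at
  \<open>y\<close> with its own integral, which invariance evaluates. Since one \<open>N\<close>
  serves all invariant measures, any two of them must agree on such \<open>g\<close>.\<close>

lemma uniform_birkhoff_mean:
  assumes rot: "has_rotation_number \<Phi> \<rho>" and irr: "\<rho> \<notin> \<rat>" and "e > 0"
  shows "\<exists>N>0. \<forall>g W V \<mu> y. dominated_variation g W V \<longrightarrow> g \<in> borel_measurable borel \<longrightarrow>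
       circle_invariant_measure \<Phi> \<mu> \<longrightarrow>
       \<bar>(\<Sum>i<N. g ((\<Phi> ^^ i) y)) / real N - (LINT x|\<mu>. g x)\<bar> \<le> e * V"
proof -
  obtain N where N: "N > 0"
    "\<And>g W V x y. dominated_variation g W V \<Longrightarrow>
       \<bar>(\<Sum>i<N. g ((\<Phi> ^^ i) y)) - (\<Sum>i<N. g ((\<Phi> ^^ i) x))\<bar> \<le> e * V * real N"
    using uniform_birkhoff_oscillation[OF assms] by metis
  show ?thesis
  proof (intro exI[of _ N] conjI allI impI)
    fix g W V \<mu> y
    assume dom: "dominated_variation g W V" and [measurable]: "g \<in> borel_measurable borel"
      and inv: "circle_invariant_measure \<Phi> \<mu>"
    interpret prob_space \<mu> using inv by (simp add: circle_invariant_measure_def)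
    have sets: "sets \<mu> = sets (restrict_space borel {0..<1})"
      using inv by (simp add: circle_invariant_measure_def)
    have meas: "f \<in> borel_measurable \<mu>" if "f \<in> borel_measurable borel" for f :: "real \<Rightarrow> real"
      unfolding measurable_cong_sets[OF sets refl] using that by (rule measurable_restrict_space1)
    define S where "S x = (\<Sum>i<N. g ((\<Phi> ^^ i) x))" for x
    have int: "integrable \<mu> (\<lambda>x. g ((\<Phi> ^^ i) x))" for i
    proof (rule integrable_const_bound)
      show "AE x in \<mu>. norm (g ((\<Phi> ^^ i) x)) \<le> \<bar>g 0\<bar> + V"
      proof (intro always_eventually allI)
        show "norm (g ((\<Phi> ^^ i) x)) \<le> \<bar>g 0\<bar> + V" for x
          using dominated_variationD(6)[OF dom, of "(\<Phi> ^^ i) x" 0] by simp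
      qed
      show "(\<lambda>x. g ((\<Phi> ^^ i) x)) \<in> borel_measurable \<mu>" by (rule meas) simp
    qed
    have "(LINT x|\<mu>. S x) = (\<Sum>i<N. LINT x|\<mu>. g ((\<Phi> ^^ i) x))"
      unfolding S_def by (rule Bochner_Integration.integral_sum[OF int])
    also have "\<dots> = real N * (LINT x|\<mu>. g x)"
      by (simp add: invariant_measure_integral_iterate[OF inv] dominated_variationD(1)[OF dom])
    finally have S_int: "(LINT x|\<mu>. S x) = real N * (LINT x|\<mu>. g x)" .
    have "integrable \<mu> S" unfolding S_def by (intro Bochner_Integration.integrable_sum int)
    moreover have "S x \<le> S y + e * V * real N" "S y - e * V * real N \<le> S x" for x
      using N(2)[OF dom, of y x] by (auto simp: S_def abs_le_iff)
    ultimately have "(LINT x|\<mu>. S x) \<le> S y + e * V * real N" "S y - e * V * real N \<le> (LINT x|\<mu>. S x)"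
      by (auto intro!: integral_le_const integral_ge_const)
    then have "\<bar>S y - real N * (LINT x|\<mu>. g x)\<bar> \<le> e * V * real N"
      by (simp add: S_int abs_le_iff)
    moreover have "S y / real N - (LINT x|\<mu>. g x) = (S y - real N * (LINT x|\<mu>. g x)) / real N"
      using N(1) by (simp add: field_simps)
    ultimately have "\<bar>S y / real N - (LINT x|\<mu>. g x)\<bar> \<le> e * V"
      using N(1) by (simp add: abs_divide divide_le_eq)
    then show "\<bar>(\<Sum>i<N. g ((\<Phi> ^^ i) y)) / real N - (LINT x|\<mu>. g x)\<bar> \<le> e * V" by (simp add: S_def)
  qed (rule N(1))
qed

text \<open>On \<open>{0..<1}\<close> the function \<open>x \<mapsto> \<lceil>x - b\<rceil> - \<lfloor>x\<rfloor>\<close> is the indicator of \<open>{b<..<1}\<close>; its variation is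
  dominated by \<open>x \<mapsto> \<lceil>x - b\<rceil> + \<lfloor>x\<rfloor>\<close>, so its Birkhoff means determine the measure of this arc.\<close>

lemma invariant_measure_unique:
  assumes rot: "has_rotation_number \<Phi> \<rho>" and irr: "\<rho> \<notin> \<rat>"
    and inv: "circle_invariant_measure \<Phi> \<mu>" "circle_invariant_measure \<Phi> \<mu>'"
  shows "\<mu> = \<mu>'"
proof -
  let ?B = "restrict_space borel {0..<1 :: real}"
  have mu: "prob_space \<mu>" "prob_space \<mu>'" "sets \<mu> = sets ?B" "sets \<mu>' = sets ?B"
    using inv by (auto simp: circle_invariant_measure_def)
  have arc: "measure \<nu> {b<..<1} = (LINT x|\<nu>. of_int (\<lceil>x - b\<rceil> - \<lfloor>x\<rfloor>))"
    if "0 \<le> b" "b < 1" "circle_invariant_measure \<Phi> \<nu>" for b :: real and \<nu>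
  proof -
    have sets: "sets \<nu> = sets ?B" using that by (simp add: circle_invariant_measure_def)
    then have space: "space \<nu> = {0..<1}" by (metis sets_eq_imp_space_eq space_restrict_space space_borel Int_UNIV_right)
    interpret prob_space \<nu> using that by (simp add: circle_invariant_measure_def)
    have "{b<..<1} \<in> sets \<nu>" using that by (auto simp: sets sets_restrict_space_iff)
    then have "measure \<nu> {b<..<1} = (LINT x|\<nu>. indicator {b<..<1} x)" by simp
    also have "\<dots> = (LINT x|\<nu>. of_int (\<lceil>x - b\<rceil> - \<lfloor>x\<rfloor>))"
    proof (rule Bochner_Integration.integral_cong)
      fix x assume "x \<in> space \<nu>"
      then have "0 \<le> x" "x < 1" by (auto simp: space)
      moreover have "\<lfloor>x\<rfloor> = 0" using calculation by (simp add: floor_eq_iff)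
      moreover have "\<lceil>x - b\<rceil> = (if x \<le> b then 0 else 1)"
        using calculation that by (auto simp: ceiling_eq_iff)
      ultimately show "(indicator {b<..<1} x :: real) = of_int (\<lceil>x - b\<rceil> - \<lfloor>x\<rfloor>)" by simp
    qed simp
    finally show ?thesis .
  qed
  have arcs_eq: "measure \<mu> {b<..<1} = measure \<mu>' {b<..<1}" if b: "0 \<le> b" "b < 1" for b
  proof -
    define g where "g x = (of_int (\<lceil>x - b\<rceil> - \<lfloor>x\<rfloor>) :: real)" for x
    have [measurable]: "g \<in> borel_measurable borel" unfolding g_def by measurable
    have dom: "dominated_variation g (\<lambda>x. of_int (\<lceil>x - b\<rceil> + \<lfloor>x\<rfloor>)) 2"
      unfolding dominated_variation_def g_def
    proof (intro conjI allI impI)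
      fix x :: real
      have "\<lceil>x + 1 - b\<rceil> = \<lceil>x - b\<rceil> + 1" by linarith
      then show "real_of_int (\<lceil>x + 1 - b\<rceil> - \<lfloor>x + 1\<rfloor>) = of_int (\<lceil>x - b\<rceil> - \<lfloor>x\<rfloor>)"
        "real_of_int (\<lceil>x + 1 - b\<rceil> + \<lfloor>x + 1\<rfloor>) = of_int (\<lceil>x - b\<rceil> + \<lfloor>x\<rfloor>) + 2" by simp_all
    next
      fix x y :: real assume "x \<le> y"
      then have "\<lfloor>x\<rfloor> \<le> \<lfloor>y\<rfloor>" "\<lceil>x - b\<rceil> \<le> \<lceil>y - b\<rceil>" by (auto intro: floor_mono ceiling_mono)
      then have "real_of_int \<lfloor>x\<rfloor> \<le> of_int \<lfloor>y\<rfloor>" "real_of_int \<lceil>x - b\<rceil> \<le> of_int \<lceil>y - b\<rceil>"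
        by simp_all
      then show "\<bar>real_of_int (\<lceil>y - b\<rceil> - \<lfloor>y\<rfloor>) - of_int (\<lceil>x - b\<rceil> - \<lfloor>x\<rfloor>)\<bar>
          \<le> of_int (\<lceil>y - b\<rceil> + \<lfloor>y\<rfloor>) - of_int (\<lceil>x - b\<rceil> + \<lfloor>x\<rfloor>)" by simp
    qed
    \<comment> \<open>The same Birkhoff mean at 0 is within \<open>e / 2\<close> of both
      integrals.\<close>
    have "\<bar>(LINT x|\<mu>. g x) - (LINT x|\<mu>'. g x)\<bar> \<le> 0 + e" if "e > 0" for e
    proof -
      from \<open>e > 0\<close> have "e / 4 > 0" by simp
      from uniform_birkhoff_mean[OF rot irr this] obtain N
        where N: "N > 0 \<and> (\<forall>g W V \<mu> y. dominated_variation g W V \<longrightarrow> g \<in> borel_measurable borel \<longrightarrow>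
          circle_invariant_measure \<Phi> \<mu> \<longrightarrow>
          \<bar>(\<Sum>i<N. g ((\<Phi> ^^ i) y)) / real N - (LINT x|\<mu>. g x)\<bar> \<le> e / 4 * V)" ..
      note N' = N[THEN conjunct2, rule_format, OF dom \<open>g \<in> borel_measurable borel\<close>]
      show ?thesis using N'[OF inv(1), of 0] N'[OF inv(2), of 0] by linarith
    qed
    then have "\<bar>(LINT x|\<mu>. g x) - (LINT x|\<mu>'. g x)\<bar> \<le> 0" by (rule field_le_epsilon)
    then show ?thesis using arc[OF b inv(1)] arc[OF b inv(2)] by (simp add: g_def)
  qed
  have "measure \<mu> A = measure \<mu>' A" if "A \<in> sets ?B" for A
  proof -
    \<comment> \<open>Viewed on the line, the arcs become tails, and distribution functions
      determine the measure.\<close>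
    define M where "M \<nu> = distr \<nu> borel (\<lambda>x. x)" for \<nu> :: "real measure"
    have M: "real_distribution (M \<nu>)" "\<And>A. A \<in> sets borel \<Longrightarrow> measure (M \<nu>) A = measure \<nu> (A \<inter> {0..<1})"
      if \<nu>: "prob_space \<nu>" "sets \<nu> = sets ?B" for \<nu>
    proof -
      interpret prob_space \<nu> by fact
      have space: "space \<nu> = {0..<1}"
        using \<nu>(2) by (metis sets_eq_imp_space_eq space_restrict_space space_borel Int_UNIV_right)
      have id: "(\<lambda>x. x) \<in> borel_measurable \<nu>"
        unfolding measurable_cong_sets[OF \<nu>(2) refl] by (rule measurable_restrict_space1) simp
      show "real_distribution (M \<nu>)"
        unfolding M_def real_distribution_def real_distribution_axioms_def
        using prob_space_distr[OF id] by simp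
      show "\<And>A. A \<in> sets borel \<Longrightarrow> measure (M \<nu>) A = measure \<nu> (A \<inter> {0..<1})"
        unfolding M_def using id by (simp add: measure_distr space)
    qed
    have "cdf (M \<mu>) x = cdf (M \<mu>') x" for x
    proof -
      have tail: "measure \<nu> ({..x} \<inter> {0..<1}) = (if x < 0 then 0 else 1 - measure \<nu> ({x<..} \<inter> {0..<1}))"
        if \<nu>: "prob_space \<nu>" "sets \<nu> = sets ?B" for \<nu>
      proof -
        interpret prob_space \<nu> by fact
        have space: "space \<nu> = {0..<1}"
          using \<nu>(2) by (metis sets_eq_imp_space_eq space_restrict_space space_borel Int_UNIV_right)
        have "{x<..} \<inter> {0..<1} \<in> sets \<nu>" by (auto simp: \<nu>(2) sets_restrict_space_iff)
        from prob_compl[OF this] have "measure \<nu> ({0..<1} - {x<..} \<inter> {0..<1}) = 1 - measure \<nu> ({x<..} \<inter> {0..<1})"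
          by (simp add: space)
        moreover have "{0..<1} - {x<..} \<inter> {0..<1} = {..x} \<inter> {0..<1}" by auto
        moreover have "{..x} \<inter> {0..<1} = {}" if "x < 0" using that by auto
        ultimately show ?thesis by auto
      qed
      have "measure \<mu> ({x<..} \<inter> {0..<1}) = measure \<mu>' ({x<..} \<inter> {0..<1})" if "x \<ge> 0"
      proof (cases "x < 1")
        case True
        have "{x<..} \<inter> {0..<1} = {x<..<1}" using that by auto
        then show ?thesis using arcs_eq[OF that True] by simp
      next
        case False
        then have "{x<..} \<inter> {0..<1} = {}" by auto
        then show ?thesis by simp
      qed
      then have "measure \<mu> ({..x} \<inter> {0..<1}) = measure \<mu>' ({..x} \<inter> {0..<1})"
        using tail mu by simp
      then show ?thesis using M mu by (simp add: cdf_def)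
    qed
    then have "M \<mu> = M \<mu>'" using M mu by (intro cdf_unique) auto
    then show ?thesis using M(2)[OF mu(1,3), of A] M(2)[OF mu(2,4), of A] that
      by (simp add: sets_restrict_space_iff Int_absorb2)
  qed
  then show ?thesis
    using mu by (intro measure_eqI) (auto simp: finite_measure.emeasure_eq_measure prob_space.finite_measure)
qed

end

section \<open>The firing map\<close>

lemma AE_le_Linf_seminorm:
  assumes "Linf_seminorm k g \<le> ennreal r" "r \<ge> 0"
  shows "AE x in lebesgue. x \<in> {- real k..real k} \<longrightarrow> \<bar>g x\<bar> \<le> r"
proof -
  have "AE x in lebesgue_on {- real k..real k}. ennreal \<bar>g x\<bar> \<le> Linf_seminorm k g"
    unfolding Linf_seminorm_def by (rule esssup_AE)
  then have "AE x in lebesgue_on {- real k..real k}. \<bar>g x\<bar> \<le> r"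
  proof eventually_elim
    case (elim x)
    then have "ennreal \<bar>g x\<bar> \<le> ennreal r" using assms(1) by (rule order_trans)
    then show ?case using assms(2) by simp
  qed
  then show ?thesis by (subst (asm) AE_restrict_space_iff) auto
qed

lemma integrable_indicator_Icc:
  "integrable lebesgue (\<lambda>x. indicator {a..b :: real} x *\<^sub>R (c :: real))"
proof -
  have "integrable lborel (indicat_real {a..b})"
    by (intro integrable_real_indicator) (auto simp: emeasure_lborel_Icc_eq)
  then show ?thesis by (simp add: integrable_completion)
qed

lemma set_integrable_Linf_loc:
  assumes f: "f \<in> Linf_loc" and c: "continuous_on UNIV (c :: real \<Rightarrow> real)"
  shows "set_integrable lebesgue {a..b} (\<lambda>u. f u * c u)"
proof -
  obtain k :: nat where k: "max \<bar>a\<bar> \<bar>b\<bar> \<le> real k" using real_arch_simple by blast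
  obtain r where r: "Linf_seminorm k f = ennreal r" "r \<ge> 0"
    using f by (metis (mono_tags, lifting) Linf_loc_def enn2real_nonneg ennreal_enn2real infinity_ennreal_def mem_Collect_eq)
  have fm: "f \<in> borel_measurable lebesgue" using f by (simp add: Linf_loc_def)
  have cm: "c \<in> borel_measurable lebesgue"
    using borel_measurable_continuous_onI[OF c] by (intro measurable_completion) simp
  have "compact (c ` {a..b})" by (intro compact_continuous_image continuous_on_subset[OF c]) auto
  then obtain C where C: "\<And>x. x \<in> {a..b} \<Longrightarrow> \<bar>c x\<bar> \<le> C"
    using compact_imp_bounded bounded_iff by (metis image_eqI real_norm_def)
  have "AE x in lebesgue. norm (indicator {a..b} x *\<^sub>R (f x * c x)) \<le> norm (indicator {a..b} x *\<^sub>R (r * C))"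
    using AE_le_Linf_seminorm[OF eq_refl[OF r(1)] r(2)]
  proof eventually_elim
    case (elim x)
    show ?case
    proof (cases "x \<in> {a..b}")
      case True
      then have "\<bar>f x\<bar> \<le> r" "\<bar>c x\<bar> \<le> C" using elim k C by auto
      then have "\<bar>f x\<bar> * \<bar>c x\<bar> \<le> r * C" by (intro mult_mono) auto
      moreover have "r * C \<le> \<bar>r * C\<bar>" by simp
      ultimately show ?thesis using True by (simp add: abs_mult)
    qed simp
  qed
  then show ?thesis unfolding set_integrable_def
  proof (rule Bochner_Integration.integrable_bound[OF integrable_indicator_Icc, rotated])
    have "{a..b} \<in> sets lebesgue" by simp
    then show "(\<lambda>x. indicator {a..b} x *\<^sub>R (f x * c x)) \<in> borel_measurable lebesgue"
      by (intro borel_measurable_scaleR borel_measurable_times borel_measurable_indicator fm cm)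
  qed
qed

section \<open>The primitive of the input and the firing time\<close>

locale firing_input =
  fixes \<sigma> :: real and f :: "real \<Rightarrow> real"
  assumes \<sigma>: "\<sigma> \<ge> 0" and f_Linf: "f \<in> Linf_loc" and f_per: "periodic1 f"
    and f_pos: "AE t in lebesgue. f t - \<sigma> > 0"
begin

definition w :: "real \<Rightarrow> real" where "w u = (f u - \<sigma>) * exp (\<sigma> * u)"

text \<open>A primitive of \<open>w\<close> on the whole line: integrals over reversed intervals are
  0, so at each \<open>x\<close> at most one term is present. The firing condition from
  \<open>t\<close> then reads \<open>P s - P t \<ge> exp (\<sigma> * t)\<close>.\<close>

definition P :: "real \<Rightarrow> real" where "P x = integral {0..x} w - integral {x..0} w"

lemma w_integrable: "set_integrable lebesgue {a..b} w"
proof -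
  have "set_integrable lebesgue {a..b} (\<lambda>u. f u * exp (\<sigma> * u) - \<sigma> * exp (\<sigma> * u))"
  proof (intro set_integral_diff)
    show "set_integrable lebesgue {a..b} (\<lambda>u. f u * exp (\<sigma> * u))"
      by (intro set_integrable_Linf_loc f_Linf continuous_intros)
    have "continuous_on {a..b} (\<lambda>u. \<sigma> * exp (\<sigma> * u))" by (intro continuous_intros)
    then show "set_integrable lebesgue {a..b} (\<lambda>u. \<sigma> * exp (\<sigma> * u))"
      using absolutely_integrable_continuous_real by blast
  qed
  then show ?thesis by (simp add: w_def[abs_def] algebra_simps)
qed

lemma w_integrable_on: "w integrable_on {a..b}"
  using set_lebesgue_integral_eq_integral(1)[OF w_integrable] .

lemma set_integral_w: "(LINT u:{a..b}|lebesgue. w u) = integral {a..b} w"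
  using set_lebesgue_integral_eq_integral(2)[OF w_integrable] .

lemma P_diff: assumes "t \<le> s" shows "integral {t..s} w = P s - P t"
proof -
  have add: "integral {a..c} w + integral {c..b} w = integral {a..b} w" if "a \<le> c" "c \<le> b" for a b c
    using that w_integrable_on by (rule Henstock_Kurzweil_Integration.integral_combine)
  have [simp]: "integral {a..b} w = 0" if "b \<le> a" for a b
    using that by (cases "a = b") auto
  show ?thesis
    using assms add[of 0 t s] add[of t 0 s] add[of t s 0] by (cases "0 \<le> t"; cases "0 \<le> s") (auto simp: P_def)
qed

lemma P_cont: "isCont P x"
proof -
  obtain k where k: "\<bar>x\<bar> < k" "0 < k" by (meson gt_ex le_less_trans abs_ge_zero)
  have "continuous_on {- k..k} (\<lambda>y. integral {- k..y} w + P (- k))"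
    by (intro continuous_intros indefinite_integral_continuous_1 w_integrable_on)
  then have "continuous_on {- k..k} P"
    by (rule continuous_on_eq) (simp add: P_diff)
  then show ?thesis using k by (intro continuous_on_interior) (auto simp: abs_less_iff)
qed

lemma w_pos: "AE x in lebesgue. w x > 0"
  using f_pos by eventually_elim (simp add: w_def)

lemma P_strict_mono: assumes "t < s" shows "P t < P s"
proof -
  have int: "integrable lebesgue (\<lambda>x. indicator {t..s} x *\<^sub>R w x)"
    using w_integrable by (simp add: set_integrable_def)
  have nonneg: "AE x in lebesgue. 0 \<le> indicator {t..s} x *\<^sub>R w x"
    using w_pos by eventually_elim simp
  have "(LINT x|lebesgue. indicator {t..s} x *\<^sub>R w x) \<noteq> 0"
  proof
    assume "(LINT x|lebesgue. indicator {t..s} x *\<^sub>R w x) = 0"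
    then have "AE x in lebesgue. indicator {t..s} x *\<^sub>R w x = 0"
      using integral_nonneg_eq_0_iff_AE[OF int nonneg] by simp
    with w_pos have "AE x in lebesgue. x \<notin> {t..s}"
      by eventually_elim (auto simp: indicator_def split: if_splits)
    then have "{t..s} \<in> null_sets lebesgue"
      by (subst AE_iff_null_sets) auto
    then have "emeasure lborel {t..s} = 0" by auto
    then show False using assms by simp
  qed
  then have "(LINT u:{t..s}|lebesgue. w u) > 0"
    using integral_nonneg_AE[OF nonneg] unfolding set_lebesgue_integral_def by linarith
  then show ?thesis using P_diff[of t s] assms by (simp add: set_integral_w)
qed

lemma P_less_iff: "P t < P s \<longleftrightarrow> t < s"
  using P_strict_mono by (metis linorder_neqE_linordered_idom order.asym)

lemma P_le_iff: "P t \<le> P s \<longleftrightarrow> t \<le> s"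
  using P_less_iff by (simp flip: not_less)

lemma P_eq_iff: "P t = P s \<longleftrightarrow> t = s"
  by (simp add: order_eq_iff P_le_iff)

text \<open>Advancing time by a period leaves \<open>f\<close> unchanged outside a null set and
  multiplies the weight by \<open>exp \<sigma>\<close>.\<close>

lemma P_shift: "P (s + 1) - P (t + 1) = exp \<sigma> * (P s - P t)"
proof -
  have le: "P (s + 1) - P (t + 1) = exp \<sigma> * (P s - P t)" if "t \<le> s" for s t
  proof -
    obtain N where "{x \<in> space lebesgue. f (x + 1) \<noteq> f x} \<subseteq> N" "emeasure lebesgue N = 0" "N \<in> sets lebesgue"
      using f_per[unfolded periodic1_def] by (auto elim!: AE_E)
    then have N: "negligible N" "{x. f (x + 1) \<noteq> f x} \<subseteq> N"
      by (auto simp: negligible_iff_null_sets null_sets_def)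
    have f_shift: "f (1 + x) = f x" if "x \<notin> N" for x
      by (subst add.commute) (use N(2) that in blast)
    have "P (s + 1) - P (t + 1) = integral {t..s} (w \<circ> (+) 1)"
      using P_diff[of "t + 1" "s + 1"] that integral_shift_Icc_real[of t s w 1] by simp
    also have "\<dots> = integral {t..s} (\<lambda>x. exp \<sigma> * w x)"
      by (rule integral_spike[OF N(1)]) (simp add: w_def exp_add f_shift distrib_left)
    also have "\<dots> = exp \<sigma> * integral {t..s} w" by simp
    finally show ?thesis using P_diff[OF that] by simp
  qed
  show ?thesis
  proof (cases "t \<le> s")
    case False
    with le[of s t] show ?thesis by (simp add: algebra_simps)
  qed (rule le)
qed

text \<open>Positivity almost everywhere gives no uniform lower bound on \<open>w\<close>, but by
  \<open>P_shift\<close> and \<sigma> \<ge> 0 the increments between consecutive natural numbers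
  never shrink. This guarantees that a firing time exists.\<close>

lemma P_unbounded: "\<exists>s\<ge>t. P s \<ge> y"
proof -
  define d where "d = P 1 - P 0"
  have "d > 0" using P_strict_mono[of 0 1] by (simp add: d_def)
  have step: "P (real (Suc n)) - P (real n) \<ge> d" for n
  proof (induction n)
    case (Suc n)
    have "P (real (Suc (Suc n))) - P (real (Suc n)) = exp \<sigma> * (P (real (Suc n)) - P (real n))"
      using P_shift[of "real (Suc n)" "real n"] by (simp add: add.commute)
    also have "\<dots> \<ge> 1 * d" using Suc \<sigma> \<open>d > 0\<close> by (intro mult_mono) auto
    finally show ?case by simp
  qed (simp add: d_def)
  have lin: "P (real n) \<ge> P 0 + real n * d" for n
  proof (induction n)
    case (Suc n)
    then show ?case using step[of n] by (simp add: algebra_simps)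
  qed simp
  obtain m :: nat where m: "(y - P 0) / d \<le> real m" using real_arch_simple by blast
  obtain k :: nat where k: "t \<le> real k" using real_arch_simple by blast
  have "y \<le> P 0 + real m * d" using m \<open>d > 0\<close> by (simp add: field_simps)
  also have "\<dots> \<le> P (real m)" by (rule lin)
  also have "\<dots> \<le> P (max (real m) (real k))" by (simp add: P_le_iff)
  finally show ?thesis using k by (intro exI[of _ "max (real m) (real k)"]) auto
qed

text \<open>As \<open>P\<close> is continuous and strictly increasing, the set in the definition is
  a closed half-line whose left end solves the threshold equation. This equation replaces the
  infimum from here on.\<close>

lemma firing_map_eq: "P (firing_map \<sigma> f t) = P t + exp (\<sigma> * t)"
proof -
  obtain s0 where s0: "s0 \<ge> t" "P s0 \<ge> P t + exp (\<sigma> * t)" using P_unbounded by blast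
  have "continuous_on {t..s0} P" using P_cont by (simp add: continuous_at_imp_continuous_on)
  from IVT'[OF _ s0(2,1) this] obtain s where s: "t \<le> s" "P s = P t + exp (\<sigma> * t)" by auto
  have "t < s" using s by (metis P_less_iff exp_gt_zero less_add_same_cancel1)
  have "{s'. s' > t \<and> exp (\<sigma> * t) \<le> (LINT u:{t..s'}|lebesgue. (f u - \<sigma>) * exp (\<sigma> * u))} = {s..}"
  proof -
    have "exp (\<sigma> * t) \<le> (LINT u:{t..s'}|lebesgue. w u) \<longleftrightarrow> s \<le> s'" if "s' > t" for s'
    proof -
      have "(LINT u:{t..s'}|lebesgue. w u) = P s' - P t" using that by (simp add: set_integral_w P_diff)
      then show ?thesis using P_le_iff[of s s'] s(2) by auto
    qed
    then show ?thesis using \<open>t < s\<close> unfolding w_def by auto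
  qed
  then have "firing_map \<sigma> f t = s" unfolding firing_map_def by simp
  then show ?thesis using s by simp
qed

lemma firing_map_greater: "firing_map \<sigma> f t > t"
  using firing_map_eq[of t] by (metis P_less_iff exp_gt_zero less_add_same_cancel1)

lemma firing_map_le_iff: "firing_map \<sigma> f t \<le> s \<longleftrightarrow> P t + exp (\<sigma> * t) \<le> P s"
  by (metis P_le_iff firing_map_eq)

text \<open>In the threshold equation the right-hand side is continuous and strictly increasing,
  \<open>P\<close> reflects the order, and over a period the increments of \<open>P\<close> and the
  threshold scale by the same factor \<open>exp \<sigma>\<close>.\<close>

lemma circle_lift_firing_map: "circle_lift (firing_map \<sigma> f)"
proof
  let ?\<Phi> = "firing_map \<sigma> f"
  show "strict_mono ?\<Phi>"
  proof
    fix x y :: real assume "x < y"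
    then have "P (?\<Phi> x) < P (?\<Phi> y)"
      using P_strict_mono[of x y] \<sigma> by (simp add: firing_map_eq add_less_le_mono mult_left_mono)
    then show "?\<Phi> x < ?\<Phi> y" by (simp add: P_less_iff)
  qed
  show "?\<Phi> (x + 1) = ?\<Phi> x + 1" for x
  proof -
    have "P (?\<Phi> x + 1) - P (x + 1) = exp \<sigma> * exp (\<sigma> * x)"
      using P_shift[of "?\<Phi> x" x] by (simp add: firing_map_eq)
    then have "P (?\<Phi> x + 1) = P (?\<Phi> (x + 1))"
      by (simp add: firing_map_eq exp_add algebra_simps)
    then show ?thesis by (simp add: P_eq_iff)
  qed
  have "isCont ?\<Phi> x" for x
    unfolding isCont_def
  proof (rule order_tendstoI)
    have lim: "(\<lambda>y. P (?\<Phi> y)) \<midarrow>x\<rightarrow> P (?\<Phi> x)"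
      unfolding firing_map_eq using P_cont[of x] unfolding isCont_def by (intro tendsto_intros)
    fix a
    show "\<forall>\<^sub>F y in at x. a < ?\<Phi> y" if "a < ?\<Phi> x"
      using order_tendstoD(1)[OF lim, of "P a"] that by (simp add: P_less_iff)
    show "\<forall>\<^sub>F y in at x. ?\<Phi> y < a" if "?\<Phi> x < a"
      using order_tendstoD(2)[OF lim, of "P a"] that by (simp add: P_less_iff)
  qed
  then show "continuous_on UNIV ?\<Phi>" by (simp add: continuous_at_imp_continuous_on)
qed

end

text \<open>Increments of the two primitives on \<open>{0..R}\<close> differ by at most
  \<open>r * E\<close>, while the unperturbed one has slope at least \<zeta>. Hence the perturbed
  threshold is reached by time \<open>s + \<delta>\<close> and not before
  \<open>s - \<delta>\<close>. Periodicity reduces all \<open>t\<close> to one period, so a single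
  seminorm suffices.\<close>

lemma firing_map_near:
  assumes in1: "firing_input \<sigma> f1" and gap: "\<zeta> > 0" "AE t in lebesgue. f1 t - \<sigma> > \<zeta>" and "\<eta> > 0"
  obtains k r where "r > 0" "\<And>f2 t. firing_input \<sigma> f2 \<Longrightarrow>
      Linf_seminorm k (\<lambda>x. f2 x - f1 x) < ennreal r \<Longrightarrow> \<bar>firing_map \<sigma> f2 t - firing_map \<sigma> f1 t\<bar> \<le> \<eta>"
proof -
  interpret I1: firing_input \<sigma> f1 by fact
  interpret C1: circle_lift "firing_map \<sigma> f1" by (rule I1.circle_lift_firing_map)
  \<comment> \<open>The cap 1 keeps \<open>s + \<delta>\<close> inside \<open>{0..R}\<close>, where
    the primitives are compared.\<close>
  define \<delta> where "\<delta> = min \<eta> 1"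
  have \<delta>: "0 < \<delta>" "\<delta> \<le> \<eta>" "\<delta> \<le> 1" using \<open>\<eta> > 0\<close> by (auto simp: \<delta>_def)
  define R where "R = firing_map \<sigma> f1 1 + 1"
  have "R > 0" using I1.firing_map_greater[of 1] by (simp add: R_def)
  define k where "k = nat \<lceil>R\<rceil>"
  have k: "R \<le> real k" unfolding k_def by linarith
  define E where "E = R * exp (\<sigma> * R)"
  have "E > 0" using \<open>R > 0\<close> by (simp add: E_def)
  define r where "r = \<zeta> * \<delta> / (2 * E)"
  have r: "r > 0" "r * E < \<zeta> * \<delta>" using \<open>\<zeta> > 0\<close> \<delta> \<open>E > 0\<close> by (auto simp: r_def)
  \<comment> \<open>For nonnegative times the weight \<open>exp (\<sigma> * x)\<close> is at least
    1, so the gap of the input is a lower bound for the slope.\<close>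
  have lower: "I1.P b - I1.P a \<ge> \<zeta> * (b - a)" if "0 \<le> a" "a \<le> b" for a b
  proof -
    have "(LINT u:{a..b}|lebesgue. \<zeta>) \<le> (LINT u:{a..b}|lebesgue. I1.w u)"
      unfolding set_lebesgue_integral_def
    proof (rule integral_mono_AE)
      show "integrable lebesgue (\<lambda>x. indicator {a..b} x *\<^sub>R \<zeta>)"
        by (rule integrable_indicator_Icc)
      show "integrable lebesgue (\<lambda>x. indicator {a..b} x *\<^sub>R I1.w x)"
        using I1.w_integrable by (simp add: set_integrable_def)
      show "AE x in lebesgue. indicator {a..b} x *\<^sub>R \<zeta> \<le> indicator {a..b} x *\<^sub>R I1.w x"
        using gap(2)
      proof eventually_elim
        case (elim x)
        show ?case
        proof (cases "x \<in> {a..b}")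
          case True
          then have "1 \<le> exp (\<sigma> * x)" using I1.\<sigma> that by simp
          then have "\<zeta> * 1 \<le> (f1 x - \<sigma>) * exp (\<sigma> * x)" using elim gap(1) by (intro mult_mono) auto
          then show ?thesis using True by (simp add: I1.w_def)
        qed simp
      qed
    qed
    moreover have "(LINT u:{a..b}|lebesgue. \<zeta>) = \<zeta> * (b - a)"
      using that by (simp add: set_lebesgue_integral_def integral_completion)
    ultimately show ?thesis using that by (simp add: I1.set_integral_w I1.P_diff)
  qed
  show ?thesis
  proof (rule that[OF r(1)])
    fix f2 t
    assume in2: "firing_input \<sigma> f2" and near: "Linf_seminorm k (\<lambda>x. f2 x - f1 x) < ennreal r"
    interpret I2: firing_input \<sigma> f2 by fact
    interpret C2: circle_lift "firing_map \<sigma> f2" by (rule I2.circle_lift_firing_map)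
    have close: "\<bar>(I2.P b - I2.P a) - (I1.P b - I1.P a)\<bar> \<le> r * E" if "0 \<le> a" "a \<le> b" "b \<le> R" for a b
    proof -
      have diff: "set_integrable lebesgue {a..b} (\<lambda>u. I2.w u - I1.w u)"
        by (intro set_integral_diff I1.w_integrable I2.w_integrable)
      have "(I2.P b - I2.P a) - (I1.P b - I1.P a) = (LINT u:{a..b}|lebesgue. I2.w u - I1.w u)"
        using that by (subst set_integral_diff)
          (auto simp: I1.w_integrable I2.w_integrable I1.set_integral_w I2.set_integral_w I1.P_diff I2.P_diff)
      also have "\<bar>\<dots>\<bar> \<le> (LINT u:{a..b}|lebesgue. r * exp (\<sigma> * R))"
        unfolding set_lebesgue_integral_def
      proof (rule integral_abs_bound[THEN order_trans], rule integral_mono_AE)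
        show "integrable lebesgue (\<lambda>x. \<bar>indicator {a..b} x *\<^sub>R (I2.w x - I1.w x)\<bar>)"
          using diff by (auto simp: set_integrable_def)
        show "integrable lebesgue (\<lambda>x. indicator {a..b} x *\<^sub>R (r * exp (\<sigma> * R)))"
          by (rule integrable_indicator_Icc)
        show "AE x in lebesgue. \<bar>indicator {a..b} x *\<^sub>R (I2.w x - I1.w x)\<bar> \<le> indicator {a..b} x *\<^sub>R (r * exp (\<sigma> * R))"
          using AE_le_Linf_seminorm[OF less_imp_le[OF near] less_imp_le[OF r(1)]]
        proof eventually_elim
          case (elim x)
          show ?case
          proof (cases "x \<in> {a..b}")
            case True
            have "I2.w x - I1.w x = (f2 x - f1 x) * exp (\<sigma> * x)" by (simp add: I1.w_def I2.w_def algebra_simps)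
            moreover have "\<bar>f2 x - f1 x\<bar> * exp (\<sigma> * x) \<le> r * exp (\<sigma> * R)"
              using elim True that k I1.\<sigma> r(1) by (intro mult_mono) (auto intro: mult_left_mono)
            ultimately show ?thesis using True by (simp add: abs_mult)
          qed simp
        qed
      qed
      also have "\<dots> = r * exp (\<sigma> * R) * (b - a)"
        using that by (simp add: set_lebesgue_integral_def integral_completion)
      also have "\<dots> \<le> r * exp (\<sigma> * R) * R" using that r(1) by (intro mult_left_mono) auto
      finally show ?thesis by (simp add: E_def algebra_simps)
    qed
    have near01: "\<bar>firing_map \<sigma> f2 t - firing_map \<sigma> f1 t\<bar> \<le> \<delta>" if t: "0 \<le> t" "t \<le> 1" for t
    proof -
      define s where "s = firing_map \<sigma> f1 t"
      have s: "t < s" "s \<le> R - 1" "I1.P s - I1.P t = exp (\<sigma> * t)"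
        using I1.firing_map_greater[of t] C1.iterate_le[of t 1 1] t
        by (auto simp: s_def R_def I1.firing_map_eq)
      have "exp (\<sigma> * t) + \<zeta> * \<delta> \<le> I1.P (s + \<delta>) - I1.P t"
        using lower[of s "s + \<delta>"] s t \<delta> by simp
      also have "\<dots> \<le> I2.P (s + \<delta>) - I2.P t + r * E"
        using close[of t "s + \<delta>"] s t \<delta> by (simp add: abs_le_iff)
      finally have "firing_map \<sigma> f2 t \<le> s + \<delta>" using r(2) by (simp add: I2.firing_map_le_iff)
      moreover have "s - \<delta> \<le> firing_map \<sigma> f2 t"
      proof (cases "s - \<delta> \<le> t")
        case True
        then show ?thesis using I2.firing_map_greater[of t] by simp
      next
        case False
        have "I2.P (s - \<delta>) - I2.P t \<le> I1.P (s - \<delta>) - I1.P t + r * E"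
          using close[of t "s - \<delta>"] False s t \<delta> by (simp add: abs_le_iff)
        also have "\<dots> \<le> exp (\<sigma> * t) - \<zeta> * \<delta> + r * E"
          using lower[of "s - \<delta>" s] s t \<delta> False by simp
        finally have "I2.P (s - \<delta>) \<le> I2.P (firing_map \<sigma> f2 t)"
          using r(2) by (simp add: I2.firing_map_eq)
        then show ?thesis by (simp add: I2.P_le_iff)
      qed
      ultimately show ?thesis by (simp add: s_def abs_le_iff)
    qed
    have "firing_map \<sigma> f2 (frac t) - firing_map \<sigma> f1 (frac t) = firing_map \<sigma> f2 t - firing_map \<sigma> f1 t"
      by (rule frac_quasi_periodic) (simp add: C1.shift C2.shift)
    then show "\<bar>firing_map \<sigma> f2 t - firing_map \<sigma> f1 t\<bar> \<le> \<eta>"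
      using near01[of "frac t"] \<delta> by (simp add: less_imp_le[OF frac_lt_1])
  qed
qed

section \<open>Stability\<close>

text \<open>The distance tests functions that are Lipschitz on the interval only. Clamping the
  argument extends them to the line with the same constant, and measures carried by the interval do
  not see the change.\<close>

lemma fortet_mourier_le:
  assumes "real_distribution \<mu>" "real_distribution \<nu>"
    and "measure \<mu> {a..b} = 1" "measure \<nu> {a..b} = 1"
    and le: "\<And>h :: real \<Rightarrow> real. 1-lipschitz_on UNIV h \<Longrightarrow> \<bar>integral\<^sup>L \<mu> h - integral\<^sup>L \<nu> h\<bar> \<le> e"
  shows "fortet_mourier {a..b} \<mu> \<nu> \<le> ereal e"
  unfolding fortet_mourier_def
proof (rule SUP_least, clarsimp)
  fix h :: "real \<Rightarrow> real" assume h: "1-lipschitz_on {a..b} h"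
  define h' where "h' x = h (max a (min b x))" for x
  have "a \<le> b" using assms(3) by (cases "a \<le> b") auto
  have lip: "1-lipschitz_on UNIV h'"
  proof (rule lipschitz_onI)
    fix x y
    have "dist (h' x) (h' y) \<le> 1 * dist (max a (min b x)) (max a (min b y))"
      unfolding h'_def using \<open>a \<le> b\<close> by (intro lipschitz_onD[OF h]) auto
    also have "\<dots> \<le> 1 * dist x y" by (simp add: dist_real_def)
    finally show "dist (h' x) (h' y) \<le> 1 * dist x y" .
  qed simp
  have meas: "h' \<in> borel_measurable borel"
    by (intro borel_measurable_continuous_onI lipschitz_on_continuous_on[OF lip])
  have eq: "(LINT x:{a..b}|M. h x) = integral\<^sup>L M h'" if M: "real_distribution M" "measure M {a..b} = 1" for M
  proof -
    interpret real_distribution M by fact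
    have "AE x in M. x \<in> {a..b}" using M(2) by (intro AE_prob_1) auto
    then have "AE x in M. indicator {a..b} x * h' x = h' x" by eventually_elim simp
    then have "(LINT x|M. indicator {a..b} x * h' x) = integral\<^sup>L M h'"
      using meas by (intro integral_cong_AE) auto
    moreover have "(LINT x:{a..b}|M. h x) = (LINT x|M. indicator {a..b} x * h' x)"
      unfolding set_lebesgue_integral_def
      by (intro Bochner_Integration.integral_cong) (auto simp: h'_def indicator_def)
    ultimately show ?thesis by simp
  qed
  show "\<bar>(LINT x:{a..b}|\<mu>. h x) - (LINT x:{a..b}|\<nu>. h x)\<bar> \<le> e"
    using le[OF lip] assms by (simp add: eq)
qed

section \<open>Comparison over finitely many iterates and limits of runs\<close>

context circle_lift
begin

lemma uniformly_close:
  assumes "\<eta> > 0"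
  obtains \<delta> where "\<delta> > 0" "\<And>x y. \<bar>x - y\<bar> \<le> \<delta> \<Longrightarrow> \<bar>\<Phi> x - \<Phi> y\<bar> \<le> \<eta>"
proof -
  \<comment> \<open>After an integer translation \<open>x\<close> lies in \<open>{0..1}\<close>, and
    the cap 1 on the distance keeps \<open>y\<close> in \<open>{- 1..2}\<close>.\<close>
  have "uniformly_continuous_on {- 1..2} \<Phi>"
    by (intro compact_uniformly_continuous continuous_on_subset[OF cont]) auto
  then obtain d where d: "d > 0" "\<And>x y. x \<in> {- 1..2} \<Longrightarrow> y \<in> {- 1..2} \<Longrightarrow> \<bar>x - y\<bar> < d \<Longrightarrow> \<bar>\<Phi> x - \<Phi> y\<bar> < \<eta>"
    using assms unfolding uniformly_continuous_on_def dist_real_def by metis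
  show ?thesis
  proof
    show "min 1 (d / 2) > 0" using d by simp
    fix x y :: real assume xy: "\<bar>x - y\<bar> \<le> min 1 (d / 2)"
    define m where "m = - \<lfloor>x\<rfloor>"
    have "0 \<le> x + of_int m" "x + of_int m \<le> 1" unfolding m_def by linarith+
    then have "\<bar>\<Phi> (x + of_int m) - \<Phi> (y + of_int m)\<bar> < \<eta>"
      using xy d(1) by (intro d(2)) (simp_all, linarith+)
    then show "\<bar>\<Phi> x - \<Phi> y\<bar> \<le> \<eta>"
      using iterate_shift_int[of 1] by simp
  qed
qed

lemma iterates_close:
  assumes "\<eta> > 0"
  obtains \<delta> where "\<delta> > 0"
    "\<And>\<Psi> x i. (\<And>x. \<bar>\<Psi> x - \<Phi> x\<bar> \<le> \<delta>) \<Longrightarrow> i \<le> N \<Longrightarrow> \<bar>(\<Psi> ^^ i) x - (\<Phi> ^^ i) x\<bar> \<le> \<eta>"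
  using assms
proof (induction N arbitrary: \<eta> thesis)
  case 0
  show ?case by (rule "0.prems"(1)[of 1]) (use "0.prems"(2) in simp_all)
next
  case (Suc N)
  have half: "\<eta> / 2 > 0" using Suc.prems by simp
  show ?case
  proof (rule uniformly_close[OF half])
    fix d assume d: "d > 0"
      "\<And>x y. \<bar>x - y\<bar> \<le> d \<Longrightarrow> \<bar>\<Phi> x - \<Phi> y\<bar> \<le> \<eta> / 2"
    \<comment> \<open>The bound \<open>d\<close> prepares the next application of \<Phi>, the bound
      \<eta> is the claim for the iterates up to \<open>N\<close>.\<close>
    have min_pos: "min d \<eta> > 0" using d Suc.prems by simp
    show ?case
    proof (rule Suc.IH[OF _ min_pos])
      fix \<delta> assume \<delta>: "\<delta> > 0"
        "\<And>\<Psi> x i. (\<And>x. \<bar>\<Psi> x - \<Phi> x\<bar> \<le> \<delta>) \<Longrightarrow> i \<le> N \<Longrightarrow> \<bar>(\<Psi> ^^ i) x - (\<Phi> ^^ i) x\<bar> \<le> min d \<eta>"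
      show ?case
      proof (rule Suc.prems(1)[of "min \<delta> (\<eta> / 2)"])
        show "min \<delta> (\<eta> / 2) > 0" using \<delta> Suc.prems by simp
        fix \<Psi> x i assume \<Psi>: "\<And>x. \<bar>\<Psi> x - \<Phi> x\<bar> \<le> min \<delta> (\<eta> / 2)" and i: "i \<le> Suc N"
        have near: "\<bar>(\<Psi> ^^ i) x - (\<Phi> ^^ i) x\<bar> \<le> min d \<eta>" if "i \<le> N" for i
          by (rule \<delta>(2)[OF order_trans[OF \<Psi>] that]) simp
        show "\<bar>(\<Psi> ^^ i) x - (\<Phi> ^^ i) x\<bar> \<le> \<eta>"
        proof (cases "i = Suc N")
          case True
          have "\<bar>\<Psi> ((\<Psi> ^^ N) x) - \<Phi> ((\<Psi> ^^ N) x)\<bar> \<le> \<eta> / 2"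
            using \<Psi>[of "(\<Psi> ^^ N) x"] by simp
          moreover have "\<bar>\<Phi> ((\<Psi> ^^ N) x) - \<Phi> ((\<Phi> ^^ N) x)\<bar> \<le> \<eta> / 2"
            using near[of N] by (intro d(2)) simp
          ultimately have "\<bar>\<Psi> ((\<Psi> ^^ N) x) - \<Phi> ((\<Phi> ^^ N) x)\<bar> \<le> \<eta>" by linarith
          then show ?thesis using True by simp
        next
          case False
          then show ?thesis using near[of i] i by simp
        qed
      qed
    qed
  qed
qed

text \<open>Existence and uniqueness of the invariant measure give the definite description in
  \<open>the_invariant_measure\<close> its intended value.\<close>

lemma isi_distribution_irrational:
  assumes rot: "has_rotation_number \<Phi> \<rho>" and irr: "\<rho> \<notin> \<rat>"
  shows "circle_invariant_measure \<Phi> (the_invariant_measure \<Phi>)"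
    and "real_distribution (isi_distribution \<Phi>)"
    and "h \<in> borel_measurable borel \<Longrightarrow>
      integral\<^sup>L (isi_distribution \<Phi>) h = (LINT x|the_invariant_measure \<Phi>. h (\<Phi> x - x) :: real)"
    and "(\<And>x. \<Phi> x - x \<in> {a..b}) \<Longrightarrow> measure (isi_distribution \<Phi>) {a..b} = 1"
proof -
  have "\<exists>!\<mu>. circle_invariant_measure \<Phi> \<mu>"
    by (rule ex_ex1I[OF ex_invariant_measure invariant_measure_unique[OF rot irr]])
  then show inv: "circle_invariant_measure \<Phi> (the_invariant_measure \<Phi>)"
    unfolding the_invariant_measure_def by (rule theI')
  interpret prob_space "the_invariant_measure \<Phi>" using inv by (simp add: circle_invariant_measure_def)
  have sets: "sets (the_invariant_measure \<Phi>) = sets (restrict_space borel {0..<1})"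
    using inv by (simp add: circle_invariant_measure_def)
  have meas: "(\<lambda>x. \<Phi> x - x) \<in> borel_measurable (the_invariant_measure \<Phi>)"
    unfolding measurable_cong_sets[OF sets refl] by (intro measurable_restrict_space1) simp
  show "real_distribution (isi_distribution \<Phi>)"
    unfolding isi_distribution_def real_distribution_def real_distribution_axioms_def
    using prob_space_distr[OF meas] by simp
  show "integral\<^sup>L (isi_distribution \<Phi>) h = (LINT x|the_invariant_measure \<Phi>. h (\<Phi> x - x) :: real)"
    if "h \<in> borel_measurable borel"
    unfolding isi_distribution_def using meas that by (rule integral_distr)
  show "measure (isi_distribution \<Phi>) {a..b} = 1" if "\<And>x. \<Phi> x - x \<in> {a..b}"
  proof -
    have "(\<lambda>x. \<Phi> x - x) -` {a..b} = UNIV" using that by auto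
    then show ?thesis unfolding isi_distribution_def by (subst measure_distr[OF meas]) (auto simp: prob_space)
  qed
qed

lemma uniform_isi_mean:
  assumes rot: "has_rotation_number \<Phi> \<rho>" and irr: "\<rho> \<notin> \<rat>" and "e > 0"
  obtains N where "N > 0"
    "\<And>h L y. L-lipschitz_on UNIV h \<Longrightarrow>
       \<bar>(\<Sum>i<N. h ((\<Phi> ^^ Suc i) y - (\<Phi> ^^ i) y)) / real N - integral\<^sup>L (isi_distribution \<Phi>) h\<bar> \<le> e * (2 * L)"
proof -
  from uniform_birkhoff_mean[OF assms] obtain N
    where N: "N > 0 \<and> (\<forall>g W V \<mu> y. dominated_variation g W V \<longrightarrow> g \<in> borel_measurable borel \<longrightarrow>
      circle_invariant_measure \<Phi> \<mu> \<longrightarrow>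
      \<bar>(\<Sum>i<N. g ((\<Phi> ^^ i) y)) / real N - (LINT x|\<mu>. g x)\<bar> \<le> e * V)" ..
  show ?thesis
  proof (rule that)
    show "N > 0" using N by (rule conjunct1)
    fix h :: "real \<Rightarrow> real" and L y assume h: "L-lipschitz_on UNIV h"
    have [measurable]: "h \<in> borel_measurable borel"
      by (intro borel_measurable_continuous_onI lipschitz_on_continuous_on[OF h])
    show "\<bar>(\<Sum>i<N. h ((\<Phi> ^^ Suc i) y - (\<Phi> ^^ i) y)) / real N - integral\<^sup>L (isi_distribution \<Phi>) h\<bar> \<le> e * (2 * L)"
      using N[THEN conjunct2, rule_format, OF dominated_lipschitz_displacement[OF h] _ isi_distribution_irrational(1)[OF rot irr], of y]
      by (simp add: isi_distribution_irrational(3)[OF rot irr])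
  qed
qed

lemma isi_convergence_irrational:
  assumes rot: "has_rotation_number \<Phi> \<rho>" and irr: "\<rho> \<notin> \<rat>" and h: "L-lipschitz_on UNIV h"
  shows "(\<lambda>n. (\<Sum>i<n. h ((\<Phi> ^^ Suc i) t - (\<Phi> ^^ i) t)) / real n) \<longlonglongrightarrow> integral\<^sup>L (isi_distribution \<Phi>) h"
proof (rule tendstoI)
  fix e :: real assume "e > 0"
  have "L \<ge> 0" using lipschitz_on_nonneg[OF h] .
  \<comment> \<open>Adding 1 avoids a division by 0 when \<open>L = 0\<close>.\<close>
  define e' where "e' = e / (4 * (L + 1))"
  have e': "e' > 0" "e' * (2 * L) < e"
    using \<open>e > 0\<close> \<open>L \<ge> 0\<close> by (auto simp: e'_def field_simps intro!: add_pos_nonneg)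
  show "\<forall>\<^sub>F n in sequentially. dist ((\<Sum>i<n. h ((\<Phi> ^^ Suc i) t - (\<Phi> ^^ i) t)) / real n)
      (integral\<^sup>L (isi_distribution \<Phi>) h) < e"
  proof (rule uniform_isi_mean[OF rot irr e'(1)])
    fix N assume N: "N > 0"
      "\<And>h L y. L-lipschitz_on UNIV h \<Longrightarrow> \<bar>(\<Sum>i<N. h ((\<Phi> ^^ Suc i) y - (\<Phi> ^^ i) y)) / real N
        - integral\<^sup>L (isi_distribution \<Phi>) h\<bar> \<le> e' * (2 * L)"
    obtain B where B: "\<And>x. \<bar>h (\<Phi> x - x)\<bar> \<le> B" using lipschitz_displacement_bounded[OF h] by blast
    have "(\<Phi> ^^ (k + i)) t = (\<Phi> ^^ i) ((\<Phi> ^^ k) t)" for k i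
      by (metis add.commute comp_apply funpow_add)
    then have "\<forall>\<^sub>F k in sequentially. \<bar>(\<Sum>i<N. h ((\<Phi> ^^ Suc (k + i)) t - (\<Phi> ^^ (k + i)) t)) / real N
        - integral\<^sup>L (isi_distribution \<Phi>) h\<bar> \<le> e' * (2 * L)"
      using N(2)[OF h] by simp
    from cesaro_of_block_means[OF _ N(1) e'(2) this, of B] B
    show ?thesis by (simp add: dist_real_def)
  qed
qed

text \<open>The rational and the irrational case are merged here. The third property provides a
  compact interval carrying the limit, on which the Fortet-Mourier distance can be taken.\<close>

lemma ex_isi_limit:
  obtains \<nu> where "real_distribution \<nu>"
    "\<And>h L. L-lipschitz_on UNIV h \<Longrightarrow>
      (\<lambda>n. (\<Sum>i<n. h ((\<Phi> ^^ Suc i) t - (\<Phi> ^^ i) t)) / real n) \<longlonglongrightarrow> integral\<^sup>L \<nu> h"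
    "\<And>a b. (\<And>x. \<Phi> x - x \<in> {a..b}) \<Longrightarrow> measure \<nu> {a..b} = 1"
proof -
  obtain \<rho> where rot: "has_rotation_number \<Phi> \<rho>" using ex_rotation_number by blast
  show ?thesis
  proof (cases "\<rho> \<in> \<rat>")
    case True
    show ?thesis
    proof (rule isi_convergence_rational[OF rot True, of t])
      fix L q assume Lq: "q > 0" "\<And>h. continuous_on UNIV h \<Longrightarrow>
        (\<lambda>n. (\<Sum>i<n. h ((\<Phi> ^^ Suc i) t - (\<Phi> ^^ i) t)) / real n)
          \<longlonglongrightarrow> integral\<^sup>L (empirical_isi \<Phi> L q) h"
      show ?thesis
      proof (rule that[of "empirical_isi \<Phi> L q"])
        show "real_distribution (empirical_isi \<Phi> L q)"
          using Lq(1) by (rule real_distribution_empirical_isi)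
        show "measure (empirical_isi \<Phi> L q) {a..b} = 1" if "\<And>x. \<Phi> x - x \<in> {a..b}" for a b
          using Lq(1) that by (rule empirical_isi_bounds)
      qed (rule Lq(2)[OF lipschitz_on_continuous_on])
    qed
  next
    case False
    show ?thesis
    proof (rule that[of "isi_distribution \<Phi>"])
      show "real_distribution (isi_distribution \<Phi>)" using rot False by (rule isi_distribution_irrational)
      show "measure (isi_distribution \<Phi>) {a..b} = 1" if "\<And>x. \<Phi> x - x \<in> {a..b}" for a b
        using rot False that by (rule isi_distribution_irrational(4))
    qed (rule isi_convergence_irrational[OF rot False])
  qed
qed

lemma isi_mean_stable:
  assumes rot: "has_rotation_number \<Phi> \<rho>" and irr: "\<rho> \<notin> \<rat>" and "\<epsilon> > 0"
  obtains \<delta> where "\<delta> > 0"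
    "\<And>\<Psi> t h c. circle_lift \<Psi> \<Longrightarrow> (\<And>x. \<bar>\<Psi> x - \<Phi> x\<bar> \<le> \<delta>) \<Longrightarrow> 1-lipschitz_on UNIV h \<Longrightarrow>
       (\<lambda>n. (\<Sum>i<n. h ((\<Psi> ^^ Suc i) t - (\<Psi> ^^ i) t)) / real n) \<longlonglongrightarrow> c \<Longrightarrow>
       \<bar>c - integral\<^sup>L (isi_distribution \<Phi>) h\<bar> \<le> \<epsilon>"
proof -
  \<comment> \<open>A quarter of \<epsilon> is the block error of \<Phi>, with variation 2; a
    quarter comes from two iterates moved by an eighth each; half is left for the passage from
    blocks to long means.\<close>
  have eighth: "\<epsilon> / 8 > 0" using \<open>\<epsilon> > 0\<close> by simp
  show ?thesis
  proof (rule uniform_isi_mean[OF rot irr eighth])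
    fix N assume N: "N > 0" "\<And>h L y. L-lipschitz_on UNIV h \<Longrightarrow>
      \<bar>(\<Sum>i<N. h ((\<Phi> ^^ Suc i) y - (\<Phi> ^^ i) y)) / real N - integral\<^sup>L (isi_distribution \<Phi>) h\<bar> \<le> \<epsilon> / 8 * (2 * L)"
    show ?thesis
    proof (rule iterates_close[OF eighth])
      fix \<delta> assume \<delta>: "\<delta> > 0"
        "\<And>\<Psi> x i. (\<And>x. \<bar>\<Psi> x - \<Phi> x\<bar> \<le> \<delta>) \<Longrightarrow> i \<le> N \<Longrightarrow> \<bar>(\<Psi> ^^ i) x - (\<Phi> ^^ i) x\<bar> \<le> \<epsilon> / 8"
      show ?thesis
      proof (rule that[OF \<delta>(1)])
        fix \<Psi> t h c
        assume \<Psi>: "circle_lift \<Psi>" "\<And>x. \<bar>\<Psi> x - \<Phi> x\<bar> \<le> \<delta>" and h: "1-lipschitz_on UNIV h"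
          and lim: "(\<lambda>n. (\<Sum>i<n. h ((\<Psi> ^^ Suc i) t - (\<Psi> ^^ i) t)) / real n) \<longlonglongrightarrow> c"
        interpret \<Psi>: circle_lift \<Psi> by fact
        define I where "I = integral\<^sup>L (isi_distribution \<Phi>) h"
        have block: "\<bar>(\<Sum>i<N. h ((\<Psi> ^^ Suc i) y - (\<Psi> ^^ i) y)) / real N - I\<bar> \<le> \<epsilon> / 2" for y
        proof -
          have "\<bar>h ((\<Psi> ^^ Suc i) y - (\<Psi> ^^ i) y) - h ((\<Phi> ^^ Suc i) y - (\<Phi> ^^ i) y)\<bar> \<le> \<epsilon> / 4" if "i < N" for i
          proof -
            have "\<bar>(\<Psi> ^^ Suc i) y - (\<Phi> ^^ Suc i) y\<bar> \<le> \<epsilon> / 8" "\<bar>(\<Psi> ^^ i) y - (\<Phi> ^^ i) y\<bar> \<le> \<epsilon> / 8"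
              using that by (intro \<delta>(2)[OF \<Psi>(2)]; simp)+
            then have "\<bar>((\<Psi> ^^ Suc i) y - (\<Psi> ^^ i) y) - ((\<Phi> ^^ Suc i) y - (\<Phi> ^^ i) y)\<bar> \<le> \<epsilon> / 4" by linarith
            then show ?thesis
              using lipschitz_onD[OF h, of "(\<Psi> ^^ Suc i) y - (\<Psi> ^^ i) y" "(\<Phi> ^^ Suc i) y - (\<Phi> ^^ i) y"]
              by (simp add: dist_real_def)
          qed
          then have "(\<Sum>i<N. \<bar>h ((\<Psi> ^^ Suc i) y - (\<Psi> ^^ i) y) - h ((\<Phi> ^^ Suc i) y - (\<Phi> ^^ i) y)\<bar>) \<le> (\<Sum>i<N. \<epsilon> / 4)"
            by (intro sum_mono) simp
          then have "\<bar>(\<Sum>i<N. h ((\<Psi> ^^ Suc i) y - (\<Psi> ^^ i) y)) - (\<Sum>i<N. h ((\<Phi> ^^ Suc i) y - (\<Phi> ^^ i) y))\<bar> \<le> real N * (\<epsilon> / 4)"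
            unfolding sum_subtractf[symmetric] by (intro order_trans[OF sum_abs]) simp
          then have "\<bar>(\<Sum>i<N. h ((\<Psi> ^^ Suc i) y - (\<Psi> ^^ i) y)) / real N - (\<Sum>i<N. h ((\<Phi> ^^ Suc i) y - (\<Phi> ^^ i) y)) / real N\<bar> \<le> \<epsilon> / 4"
            using N(1) unfolding diff_divide_distrib[symmetric] by (simp add: abs_divide divide_le_eq mult.commute del: funpow.simps)
          moreover have "\<bar>(\<Sum>i<N. h ((\<Phi> ^^ Suc i) y - (\<Phi> ^^ i) y)) / real N - I\<bar> \<le> \<epsilon> / 4"
            using N(2)[OF h, of y] by (simp add: I_def)
          ultimately show ?thesis by linarith
        qed
        obtain B where B: "\<And>x. \<bar>h (\<Psi> x - x)\<bar> \<le> B" using \<Psi>.lipschitz_displacement_bounded[OF h] by blast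
        have "(\<Psi> ^^ (k + i)) t = (\<Psi> ^^ i) ((\<Psi> ^^ k) t)" for k i
          by (metis add.commute comp_apply funpow_add)
        then have blocks: "\<forall>\<^sub>F k in sequentially. \<bar>(\<Sum>i<N. h ((\<Psi> ^^ Suc (k + i)) t - (\<Psi> ^^ (k + i)) t)) / real N - I\<bar> \<le> \<epsilon> / 2"
          using block[of "(\<Psi> ^^ _) t"] by simp
        have "\<forall>\<^sub>F n in sequentially. \<bar>(\<Sum>i<n. h ((\<Psi> ^^ Suc i) t - (\<Psi> ^^ i) t)) / real n - I\<bar> < \<epsilon>"
          using B \<open>\<epsilon> > 0\<close> by (intro cesaro_of_block_means[OF _ N(1) _ blocks, of B]) auto
        then have "\<bar>c - I\<bar> \<le> \<epsilon>"
          by (intro tendsto_upperbound[OF tendsto_rabs[OF tendsto_diff[OF lim tendsto_const]]])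
            (auto elim: eventually_mono)
        then show "\<bar>c - integral\<^sup>L (isi_distribution \<Phi>) h\<bar> \<le> \<epsilon>" by (simp add: I_def)
      qed
    qed
  qed
qed

end

section \<open>Neighbourhoods of the input and the stability theorem\<close>

lemma Linf_neighbourhood:
  fixes k :: nat
  assumes "f \<in> Linf_loc" "r > 0"
  defines "U \<equiv> {g \<in> Linf_loc. Linf_seminorm k (\<lambda>x. g x - f x) < ennreal r}"
  shows "openin Linf_loc_topology U" "f \<in> U"
proof -
  show "openin Linf_loc_topology U"
    unfolding Linf_loc_topology_def U_def using assms by (intro topology_generated_by_Basis) blast
  have "Linf_seminorm k (\<lambda>x. f x - f x) \<le> 0"
    unfolding Linf_seminorm_def by (rule esssup_I) auto
  also have "0 < ennreal r" using assms by simp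
  finally show "f \<in> U" using assms(1) by (simp add: U_def)
qed

text \<open>Weak limits on the line are unique, so \<open>\<nu>\<close> is the limit of the run. The
  distance refers to a compact interval carrying both measures: one exists, and the bound holds for
  each, so the choice does not matter.\<close>

theorem proposition3p20:
  fixes \<sigma> \<zeta> \<rho> \<epsilon> :: real and f1 :: "real \<Rightarrow> real"
  assumes "\<sigma> \<ge> 0"
    and "f1 \<in> Linf_loc"
    and "periodic1 f1"
    and "\<zeta> > 0" and "AE t in lebesgue. f1 t - \<sigma> > \<zeta>"
    and "has_rotation_number (firing_map \<sigma> f1) \<rho>" and "\<rho> \<notin> \<rat>"
    and "\<epsilon> > 0"
  shows "\<exists>U. openin Linf_loc_topology U \<and> f1 \<in> U \<and>
    (\<forall>f2 \<in> U. periodic1 f2 \<longrightarrow> (AE t in lebesgue. f2 t - \<sigma> > 0) \<longrightarrow>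
      (\<forall>t. \<exists>\<nu>. real_distribution \<nu> \<and>
         weak_conv_m (empirical_isi (firing_map \<sigma> f2) t) \<nu> \<and>
         (\<exists>a b. measure \<nu> {a..b} = 1 \<and>
                measure (isi_distribution (firing_map \<sigma> f1)) {a..b} = 1) \<and>
         (\<forall>a b. measure \<nu> {a..b} = 1 \<longrightarrow>
                measure (isi_distribution (firing_map \<sigma> f1)) {a..b} = 1 \<longrightarrow>
                fortet_mourier {a..b} \<nu> (isi_distribution (firing_map \<sigma> f1)) < ereal \<epsilon>)))"
proof -
  let ?\<Phi> = "firing_map \<sigma>"
  have in1: "firing_input \<sigma> f1"
    using assms(1-4) by unfold_locales (auto intro: eventually_mono[OF assms(5)])
  interpret C1: circle_lift "?\<Phi> f1" by (rule firing_input.circle_lift_firing_map[OF in1])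
  \<comment> \<open>Limits and suprema preserve only weak inequalities, so half of \<epsilon> leaves
    room for the strict one.\<close>
  have half: "\<epsilon> / 2 > 0" using \<open>\<epsilon> > 0\<close> by simp
  show ?thesis
  proof (rule C1.isi_mean_stable[OF assms(6,7) half])
    fix \<delta> assume \<delta>: "\<delta> > 0"
      "\<And>\<Psi> t h c. circle_lift \<Psi> \<Longrightarrow> (\<And>x. \<bar>\<Psi> x - ?\<Phi> f1 x\<bar> \<le> \<delta>) \<Longrightarrow> 1-lipschitz_on UNIV h \<Longrightarrow>
         (\<lambda>n. (\<Sum>i<n. h ((\<Psi> ^^ Suc i) t - (\<Psi> ^^ i) t)) / real n) \<longlonglongrightarrow> c \<Longrightarrow>
         \<bar>c - integral\<^sup>L (isi_distribution (?\<Phi> f1)) h\<bar> \<le> \<epsilon> / 2"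
    show ?thesis
    proof (rule firing_map_near[OF in1 assms(4,5) \<delta>(1)])
      fix k r assume kr: "r > 0" "\<And>f2 t. firing_input \<sigma> f2 \<Longrightarrow>
          Linf_seminorm k (\<lambda>x. f2 x - f1 x) < ennreal r \<Longrightarrow> \<bar>?\<Phi> f2 t - ?\<Phi> f1 t\<bar> \<le> \<delta>"
      define U where "U = {g \<in> Linf_loc. Linf_seminorm k (\<lambda>x. g x - f1 x) < ennreal r}"
      note isi1 = C1.isi_distribution_irrational[OF assms(6,7)]
      show ?thesis
      proof (intro exI[of _ U] conjI ballI impI allI)
        show "openin Linf_loc_topology U" "f1 \<in> U"
          unfolding U_def using assms(2) kr(1) by (rule Linf_neighbourhood)+
        fix f2 t assume f2: "f2 \<in> U" "periodic1 f2" "AE t in lebesgue. f2 t - \<sigma> > 0"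
        have in2: "firing_input \<sigma> f2" using f2 assms(1) by unfold_locales (auto simp: U_def)
        interpret C2: circle_lift "?\<Phi> f2" by (rule firing_input.circle_lift_firing_map[OF in2])
        have near: "\<bar>?\<Phi> f2 x - ?\<Phi> f1 x\<bar> \<le> \<delta>" for x using kr(2)[OF in2] f2(1) by (simp add: U_def)
        show "\<exists>\<nu>. real_distribution \<nu> \<and> weak_conv_m (empirical_isi (?\<Phi> f2) t) \<nu> \<and>
             (\<exists>a b. measure \<nu> {a..b} = 1 \<and> measure (isi_distribution (?\<Phi> f1)) {a..b} = 1) \<and>
             (\<forall>a b. measure \<nu> {a..b} = 1 \<longrightarrow> measure (isi_distribution (?\<Phi> f1)) {a..b} = 1 \<longrightarrow>
                    fortet_mourier {a..b} \<nu> (isi_distribution (?\<Phi> f1)) < ereal \<epsilon>)"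
        proof (rule C2.ex_isi_limit[of t])
          fix \<nu> assume \<nu>: "real_distribution \<nu>"
            "\<And>h L. L-lipschitz_on UNIV h \<Longrightarrow>
              (\<lambda>n. (\<Sum>i<n. h ((?\<Phi> f2 ^^ Suc i) t - (?\<Phi> f2 ^^ i) t)) / real n) \<longlonglongrightarrow> integral\<^sup>L \<nu> h"
            "\<And>a b. (\<And>x. ?\<Phi> f2 x - x \<in> {a..b}) \<Longrightarrow> measure \<nu> {a..b} = 1"
          show ?thesis
          proof (intro exI[of _ \<nu>] conjI allI impI)
            show "real_distribution \<nu>" by fact
            show "weak_conv_m (empirical_isi (?\<Phi> f2) t) \<nu>"
              using \<nu>(1,2) by (rule weak_conv_empirical_isi)
            define a b where "a = min (?\<Phi> f1 0 - 1) (?\<Phi> f2 0 - 1)" and "b = max (?\<Phi> f1 0 + 1) (?\<Phi> f2 0 + 1)"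
            have "?\<Phi> f1 x - x \<in> {a..b}" "?\<Phi> f2 x - x \<in> {a..b}" for x
              using C1.displacement_bounds[of x] C2.displacement_bounds[of x] by (auto simp: a_def b_def)
            then show "\<exists>a b. measure \<nu> {a..b} = 1 \<and> measure (isi_distribution (?\<Phi> f1)) {a..b} = 1"
              using \<nu>(3) isi1(4) by blast
            fix a b assume ab: "measure \<nu> {a..b} = 1" "measure (isi_distribution (?\<Phi> f1)) {a..b} = 1"
            have "fortet_mourier {a..b} \<nu> (isi_distribution (?\<Phi> f1)) \<le> ereal (\<epsilon> / 2)"
              using \<nu>(1) isi1(2) ab
              by (rule fortet_mourier_le) (rule \<delta>(2)[OF C2.circle_lift_axioms near _ \<nu>(2)])
            also have "\<dots> < ereal \<epsilon>" using \<open>\<epsilon> > 0\<close> by simp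
            finally show "fortet_mourier {a..b} \<nu> (isi_distribution (?\<Phi> f1)) < ereal \<epsilon>" .
          qed
        qed
      qed
    qed
  qed
qed

end
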